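(* Let $n\in\{1,2,3\}$, let $Q'$ be any quiver whose underlying graph is the Dynkin graph $A_n$ (a path on vertices $1,\dots,n$ with arbitrary orientation of the edges), let $N_1,\dots,N_n\geq 0$ be integers, and let $Q$ be obtained from $Q'$ by adding $N_i$ loops at vertex $i$. Let $A=\Bbbk Q/(\geq 2)$. Then $$\operatorname{fpd}(A\text{-mod})=\max\{N_1,\dots,N_n\}.$$ In particular, for $n\le 3$ the Frobenius–Perron dimension of the modified type-A algebra $A(n)$ does not depend on the orientation of the non-loop arrows.
   Context: $\Bbbk$ is an algebraically closed field; $\Bbbk Q$ is the path algebra with $e_i\alpha=\delta_{i,t(\alpha)}\alpha$, $\alpha e_j=\delta_{j,s(\alpha)}\alpha$; $(\geq 2)$ is the ideal generated by paths of length $\geq 2$; $A\text{-mod}$ is the category of finite-dimensional left $A$-modules. For a $\Bbbk$-linear abelian category $\mathcal C$: an object $M$ is a brick if $\mathrm{Hom}(M,M)=\Bbbk$; a finite set $\phi=\{X_1,\dots,X_k\}$ of nonzero objects is a brick set if each $X_i$ is a brick and $\dim\mathrm{Hom}(X_i,X_j)=\delta_{ij}$; its adjacency matrix is $A(\phi)=(\dim\mathrm{Ext}^1_{\mathcal C}(X_i,X_j))_{i,j}$; and $\operatorname{fpd}(\mathcal C)=\sup_{\phi}\rho(A(\phi))$, the supremum over all brick sets of the spectral radius $\rho$. *)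

theory Defs
  imports "Jordan_Normal_Form.Spectral_Radius" "HOL-Library.Extended_Real"
begin

definition alg_closed :: "'k::field itself \<Rightarrow> bool" where
  "alg_closed _ \<longleftrightarrow> (\<forall>p :: 'k poly. degree p \<noteq> 0 \<longrightarrow> (\<exists>x. poly p x = 0))"

text \<open>A quiver is given by a vertex set V (of naturals), an arrow set Ar, and source
  and target maps s, t.  A finite-dimensional left module over kQ/(paths of length >= 2)
  is the same as a representation (d, M) of Q: a space k^(d i) at each vertex i and a
  matrix M a : k^(d (s a)) -> k^(d (t a)) for each arrow a, such that every composite
  of two arrows acts as zero.\<close>

type_synonym ('k, 'a) qrep = "(nat \<Rightarrow> nat) \<times> ('a \<Rightarrow> 'k mat)"

definition is_rep :: "nat set \<Rightarrow> 'a set \<Rightarrow> ('a \<Rightarrow> nat) \<Rightarrow> ('a \<Rightarrow> nat) \<Rightarrow> ('k::field, 'a) qrep \<Rightarrow> bool" where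
  "is_rep V Ar s t X \<longleftrightarrow>
     (\<forall>i. i \<notin> V \<longrightarrow> fst X i = 0) \<and>
     (\<forall>a\<in>Ar. snd X a \<in> carrier_mat (fst X (t a)) (fst X (s a))) \<and>
     (\<forall>a. a \<notin> Ar \<longrightarrow> snd X a = 0\<^sub>m (fst X (t a)) (fst X (s a))) \<and>
     (\<forall>a\<in>Ar. \<forall>b\<in>Ar. t a = s b \<longrightarrow>
        snd X b * snd X a = 0\<^sub>m (fst X (t b)) (fst X (s a)))"

definition lincomb :: "('i \<Rightarrow> nat) \<Rightarrow> ('i \<Rightarrow> nat) \<Rightarrow> (nat \<Rightarrow> 'k::field) \<Rightarrow> ('i \<Rightarrow> 'k mat) list \<Rightarrow> 'i \<Rightarrow> 'k mat" where
  "lincomb R C c fs = (\<lambda>x. mat (R x) (C x) (\<lambda>(i, j). \<Sum>k<length fs. c k * ((fs ! k) x) $$ (i, j)))"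

text \<open>Dimension of the quotient space S/T (T a subspace of S), for spaces of families of
  matrices of shape R x by C x: the maximal length of a list in S that is linearly
  independent modulo T.\<close>
definition qdim :: "('i \<Rightarrow> nat) \<Rightarrow> ('i \<Rightarrow> nat) \<Rightarrow> ('i \<Rightarrow> 'k::field mat) set \<Rightarrow> ('i \<Rightarrow> 'k mat) set \<Rightarrow> nat" where
  "qdim R C S T = Max {length fs | fs. set fs \<subseteq> S \<and>
       (\<forall>c. lincomb R C c fs \<in> T \<longrightarrow> (\<forall>k<length fs. c k = 0))}"

definition hom_set :: "'a set \<Rightarrow> ('a \<Rightarrow> nat) \<Rightarrow> ('a \<Rightarrow> nat) \<Rightarrow> ('k::field, 'a) qrep \<Rightarrow> ('k, 'a) qrep \<Rightarrow> (nat \<Rightarrow> 'k mat) set" where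
  "hom_set Ar s t X Y = {f. (\<forall>i. f i \<in> carrier_mat (fst Y i) (fst X i)) \<and>
       (\<forall>a\<in>Ar. f (t a) * snd X a = snd Y a * f (s a))}"

definition dim_hom :: "'a set \<Rightarrow> ('a \<Rightarrow> nat) \<Rightarrow> ('a \<Rightarrow> nat) \<Rightarrow> ('k::field, 'a) qrep \<Rightarrow> ('k, 'a) qrep \<Rightarrow> nat" where
  "dim_hom Ar s t X Y = qdim (fst Y) (fst X) (hom_set Ar s t X Y) {\<lambda>i. 0\<^sub>m (fst Y i) (fst X i)}"

text \<open>Extensions 0 -> Y -> E -> X -> 0: E has underlying space Y (+) X at each vertex and
  arrow matrices [[Y a, h a], [0, X a]] with h a : X_(s a) -> Y_(t a); E must again be a
  module (composites of arrows vanish).  Two such are equivalent iff the difference of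
  the h's is a coboundary  a |-> Y a * g (s a) - g (t a) * X a.\<close>

definition ext_rep :: "'a set \<Rightarrow> ('a \<Rightarrow> nat) \<Rightarrow> ('a \<Rightarrow> nat) \<Rightarrow> ('k::field, 'a) qrep \<Rightarrow> ('k, 'a) qrep \<Rightarrow> ('a \<Rightarrow> 'k mat) \<Rightarrow> ('k, 'a) qrep" where
  "ext_rep Ar s t X Y h = ((\<lambda>i. fst Y i + fst X i),
     (\<lambda>a. if a \<in> Ar then four_block_mat (snd Y a) (h a) (0\<^sub>m (fst X (t a)) (fst Y (s a))) (snd X a)
          else 0\<^sub>m (fst Y (t a) + fst X (t a)) (fst Y (s a) + fst X (s a))))"

definition ext_cocycles :: "nat set \<Rightarrow> 'a set \<Rightarrow> ('a \<Rightarrow> nat) \<Rightarrow> ('a \<Rightarrow> nat) \<Rightarrow> ('k::field, 'a) qrep \<Rightarrow> ('k, 'a) qrep \<Rightarrow> ('a \<Rightarrow> 'k mat) set" where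
  "ext_cocycles V Ar s t X Y = {h. (\<forall>a. h a \<in> carrier_mat (fst Y (t a)) (fst X (s a))) \<and>
       (\<forall>a. a \<notin> Ar \<longrightarrow> h a = 0\<^sub>m (fst Y (t a)) (fst X (s a))) \<and>
       is_rep V Ar s t (ext_rep Ar s t X Y h)}"

definition ext_coboundaries :: "'a set \<Rightarrow> ('a \<Rightarrow> nat) \<Rightarrow> ('a \<Rightarrow> nat) \<Rightarrow> ('k::field, 'a) qrep \<Rightarrow> ('k, 'a) qrep \<Rightarrow> ('a \<Rightarrow> 'k mat) set" where
  "ext_coboundaries Ar s t X Y = {h. \<exists>g. (\<forall>i. g i \<in> carrier_mat (fst Y i) (fst X i)) \<and>
       (\<forall>a. h a = (if a \<in> Ar then snd Y a * g (s a) - g (t a) * snd X a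
                    else 0\<^sub>m (fst Y (t a)) (fst X (s a))))}"

definition dim_ext1 :: "nat set \<Rightarrow> 'a set \<Rightarrow> ('a \<Rightarrow> nat) \<Rightarrow> ('a \<Rightarrow> nat) \<Rightarrow> ('k::field, 'a) qrep \<Rightarrow> ('k, 'a) qrep \<Rightarrow> nat" where
  "dim_ext1 V Ar s t X Y = qdim (\<lambda>a. fst Y (t a)) (\<lambda>a. fst X (s a))
       (ext_cocycles V Ar s t X Y) (ext_coboundaries Ar s t X Y)"

definition is_brick :: "nat set \<Rightarrow> 'a set \<Rightarrow> ('a \<Rightarrow> nat) \<Rightarrow> ('a \<Rightarrow> nat) \<Rightarrow> ('k::field, 'a) qrep \<Rightarrow> bool" where
  "is_brick V Ar s t X \<longleftrightarrow> is_rep V Ar s t X \<and> dim_hom Ar s t X X = 1"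

text \<open>A brick set {X_1,...,X_k}, listed in some order (the spectral radius does not
  depend on the order).\<close>
definition brick_set :: "nat set \<Rightarrow> 'a set \<Rightarrow> ('a \<Rightarrow> nat) \<Rightarrow> ('a \<Rightarrow> nat) \<Rightarrow> ('k::field, 'a) qrep list \<Rightarrow> bool" where
  "brick_set V Ar s t Xs \<longleftrightarrow> Xs \<noteq> [] \<and>
     (\<forall>i<length Xs. is_brick V Ar s t (Xs ! i)) \<and>
     (\<forall>i<length Xs. \<forall>j<length Xs. dim_hom Ar s t (Xs ! i) (Xs ! j) = (if i = j then 1 else 0))"

definition adj_mat :: "nat set \<Rightarrow> 'a set \<Rightarrow> ('a \<Rightarrow> nat) \<Rightarrow> ('a \<Rightarrow> nat) \<Rightarrow> ('k::field, 'a) qrep list \<Rightarrow> complex mat" where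
  "adj_mat V Ar s t Xs = mat (length Xs) (length Xs)
      (\<lambda>(i, j). of_nat (dim_ext1 V Ar s t (Xs ! i) (Xs ! j)))"

definition fpd :: "'k::field itself \<Rightarrow> nat set \<Rightarrow> 'a set \<Rightarrow> ('a \<Rightarrow> nat) \<Rightarrow> ('a \<Rightarrow> nat) \<Rightarrow> ereal" where
  "fpd _ V Ar s t = (SUP Xs \<in> {Xs :: ('k, 'a) qrep list. brick_set V Ar s t Xs}.
                        ereal (spectral_radius (adj_mat V Ar s t Xs)))"

datatype qarrow = Edge nat | Loop nat nat

definition typeA_vertices :: "nat \<Rightarrow> nat set" where
  "typeA_vertices n = {1..n}"

definition typeA_arrows :: "nat \<Rightarrow> (nat \<Rightarrow> nat) \<Rightarrow> qarrow set" where
  "typeA_arrows n N = {Edge i | i. 1 \<le> i \<and> i < n} \<union> {Loop i j | i j. 1 \<le> i \<and> i \<le> n \<and> j < N i}"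

fun typeA_src :: "(nat \<Rightarrow> bool) \<Rightarrow> qarrow \<Rightarrow> nat" where
  "typeA_src orient (Edge i) = (if orient i then i else i + 1)"
| "typeA_src orient (Loop i j) = i"

fun typeA_tgt :: "(nat \<Rightarrow> bool) \<Rightarrow> qarrow \<Rightarrow> nat" where
  "typeA_tgt orient (Edge i) = (if orient i then i + 1 else i)"
| "typeA_tgt orient (Loop i j) = i"

end

theory Submission
  imports Defs
begin

text \<open>A nonzero module with radical square zero over a star with at most two leaves (and loops) has
  a nonzero endomorphism that has rank at most one at every vertex. On a brick this endomorphism is
  a scalar, so a brick has dimension at most one at every vertex and everything is computed with
  scalars. The arrows at the middle vertex that act nontrivially on a brick either all end or all
  start there, and orthogonal bricks through the middle vertex must agree in this respect, which
  leaves no extensions between them. Hence a brick set can be ordered so that its adjacency matrix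
  is triangular. The diagonal entry is the number of loops for a simple brick and 0 for every other
  brick.\<close>

section \<open>Dimensions of quotient spaces\<close>

text \<open>The endomorphism has the form \<open>outer (w i) (\<phi> i)\<close>. If one vertex
  carries both a nonzero vector of the socle and a nonzero linear form on the top, the composite M
  -> top -> socle -> M is one. Otherwise every vertex only emits or only receives nonzero arrows;
  this kills the loops and, up to transposition, leaves edges that point into the centre. If a
  nonzero covector at the centre is killed by one edge, the construction runs along the other edge
  alone. If there is none, both edges are invertible and it runs along both at once. This dichotomy
  is where having only two leaves enters. The triangular order follows the arrows: an extension of X
  by Y needs a common vertex of the supports or an arrow from the support of X to that of Y, and
  orthogonality rules out the cases that run against the order. Since \<open>qdim\<close> is a
  \<open>Max\<close> over lengths of lists, bounds on these lengths accompany its use.\<close>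

lemma exists_dependence:
  fixes u :: "'b \<Rightarrow> 'c \<Rightarrow> 'k::field"
  assumes "finite I" "finite K" "card I < card K"
  shows "\<exists>c. (\<exists>k\<in>K. c k \<noteq> 0) \<and> (\<forall>x\<in>I. (\<Sum>k\<in>K. c k * u k x) = 0)"
  using assms
proof (induction I arbitrary: K u rule: finite_induct)
  case empty
  then have "K \<noteq> {}" by auto
  then show ?case by (intro exI[of _ "\<lambda>_. 1"]) auto
next
  case (insert x I)
  show ?case
  proof (cases "\<forall>k\<in>K. u k x = 0")
    case True
    from insert obtain c where "\<exists>k\<in>K. c k \<noteq> 0" "\<forall>x\<in>I. (\<Sum>k\<in>K. c k * u k x) = 0"
      by (metis Suc_lessD card_insert_disjoint)
    with True show ?thesis by (intro exI[of _ c]) auto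
  next
    case False
    then obtain l where l: "l \<in> K" "u l x \<noteq> 0" by auto
    \<comment> \<open>Gaussian elimination with pivot \<open>l\<close>: coordinate \<open>x\<close>
      of every \<open>v k\<close> vanishes, and the coefficient \<open>- b\<close> of the pivot in
      \<open>e\<close> undoes the subtraction.\<close>
    define v where "v k y = u k y - u k x / u l x * u l y" for k y
    have "card I < card (K - {l})" using insert l by simp
    then obtain c where c: "\<exists>k\<in>K - {l}. c k \<noteq> 0" "\<forall>y\<in>I. (\<Sum>k\<in>K - {l}. c k * v k y) = 0"
      using insert.IH[of "K - {l}" v] insert.prems by auto
    define b where "b = (\<Sum>k\<in>K - {l}. c k * u k x) / u l x"
    define e where "e = c(l := - b)"
    have e: "(\<Sum>k\<in>K. e k * u k y) = (\<Sum>k\<in>K - {l}. c k * v k y)" for y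
    proof -
      have "(\<Sum>k\<in>K. e k * u k y) = - b * u l y + (\<Sum>k\<in>K - {l}. e k * u k y)"
        using l insert.prems by (simp add: sum.remove e_def)
      also have "(\<Sum>k\<in>K - {l}. e k * u k y) = (\<Sum>k\<in>K - {l}. c k * u k y)"
        by (rule sum.cong) (auto simp: e_def)
      also have "b * u l y = (\<Sum>k\<in>K - {l}. c k * (u k x / u l x * u l y))"
        by (simp add: b_def sum_distrib_right sum_divide_distrib mult.assoc)
      then have "- b * u l y + (\<Sum>k\<in>K - {l}. c k * u k y) = (\<Sum>k\<in>K - {l}. c k * v k y)"
        by (simp add: v_def right_diff_distrib sum_subtractf)
      finally show ?thesis .
    qed
    have "\<forall>k. v k x = 0" using l by (simp add: v_def)
    with c(2) have "\<forall>y\<in>insert x I. (\<Sum>k\<in>K. e k * u k y) = 0"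
      by (simp add: e)
    moreover have "\<exists>k\<in>K. e k \<noteq> 0" using c(1) by (auto simp: e_def)
    ultimately show ?thesis by blast
  qed
qed

definition indep_mod :: "('i \<Rightarrow> nat) \<Rightarrow> ('i \<Rightarrow> nat) \<Rightarrow> ('i \<Rightarrow> 'k::field mat) set \<Rightarrow> ('i \<Rightarrow> 'k mat) list \<Rightarrow> bool" where
  "indep_mod R C T fs \<longleftrightarrow> (\<forall>c. lincomb R C c fs \<in> T \<longrightarrow> (\<forall>k<length fs. c k = 0))"

text \<open>Only the entries indexed by \<open>I\<close> can be nonzero, so a longer list has a
  nontrivial combination equal to the zero family, which lies in \<open>T\<close>. This supplies the
  length bounds for Hom and Ext.\<close>

lemma indep_mod_length_le:
  assumes "finite I" and "(\<lambda>x. 0\<^sub>m (R x) (C x)) \<in> T"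
    and supp: "\<And>f x i j. \<lbrakk>f \<in> S; i < R x; j < C x; (x, i, j) \<notin> I\<rbrakk> \<Longrightarrow> f x $$ (i, j) = 0"
    and "set fs \<subseteq> S" "indep_mod R C T fs"
  shows "length fs \<le> card I"
proof (rule ccontr)
  assume "\<not> length fs \<le> card I"
  then have "card I < card {..<length fs}" by simp
  then obtain c where c: "\<exists>k\<in>{..<length fs}. c k \<noteq> 0"
    "\<forall>p\<in>I. (\<Sum>k<length fs. c k * (case p of (x, ij) \<Rightarrow> (fs ! k) x $$ ij)) = 0"
    using exists_dependence[of I "{..<length fs}" "\<lambda>k (x, ij). (fs ! k) x $$ ij"] assms(1) by auto
  have "(\<Sum>k<length fs. c k * (fs ! k) x $$ (i, j)) = 0" if "i < R x" "j < C x" for x i j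
  proof (cases "(x, i, j) \<in> I")
    case True
    with c(2) show ?thesis by force
  next
    case False
    then have "(fs ! k) x $$ (i, j) = 0" if "k < length fs" for k
      using supp \<open>i < R x\<close> \<open>j < C x\<close> assms(4) that nth_mem by blast
    then show ?thesis by simp
  qed
  then have "lincomb R C c fs = (\<lambda>x. 0\<^sub>m (R x) (C x))"
    by (auto simp: lincomb_def fun_eq_iff intro!: eq_matI)
  with assms(2,5) c(1) show False by (auto simp: indep_mod_def)
qed

lemma qdim_alt: "qdim R C S T = Max (length ` {fs. set fs \<subseteq> S \<and> indep_mod R C T fs})"
  by (simp add: qdim_def indep_mod_def setcompr_eq_image)

lemma qdim_le:
  assumes "\<And>fs. set fs \<subseteq> S \<Longrightarrow> indep_mod R C T fs \<Longrightarrow> length fs \<le> m"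
  shows "qdim R C S T \<le> m"
proof -
  let ?L = "length ` {fs. set fs \<subseteq> S \<and> indep_mod R C T fs}"
  have "finite ?L" by (rule finite_subset[of _ "{..m}"]) (auto simp: assms)
  moreover have "[] \<in> {fs. set fs \<subseteq> S \<and> indep_mod R C T fs}" by (simp add: indep_mod_def)
  ultimately show ?thesis unfolding qdim_alt using assms by (subst Max_le_iff) blast+
qed

text \<open>The bound \<open>m\<close> serves to make the set of lengths finite; \<open>Max\<close>
  of an infinite set would say nothing.\<close>

lemma qdim_ge:
  assumes "\<And>fs. set fs \<subseteq> S \<Longrightarrow> indep_mod R C T fs \<Longrightarrow> length fs \<le> m"
    and "set fs \<subseteq> S" "indep_mod R C T fs"
  shows "length fs \<le> qdim R C S T"
proof -
  have "finite (length ` {fs. set fs \<subseteq> S \<and> indep_mod R C T fs})"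
    by (rule finite_subset[of _ "{..m}"]) (auto simp: assms(1))
  then show ?thesis unfolding qdim_alt using assms(2,3) by (intro Max_ge) auto
qed

lemma qdim_attained:
  assumes "\<And>fs. set fs \<subseteq> S \<Longrightarrow> indep_mod R C T fs \<Longrightarrow> length fs \<le> m"
  obtains fs where "set fs \<subseteq> S" "indep_mod R C T fs" "length fs = qdim R C S T"
proof -
  let ?L = "length ` {fs. set fs \<subseteq> S \<and> indep_mod R C T fs}"
  have "finite ?L" by (rule finite_subset[of _ "{..m}"]) (auto simp: assms)
  moreover have "[] \<in> {fs. set fs \<subseteq> S \<and> indep_mod R C T fs}" by (simp add: indep_mod_def)
  ultimately have "qdim R C S T \<in> ?L" unfolding qdim_alt by (intro Max_in) blast+
  then show thesis using that by auto
qed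

section \<open>Linear algebra\<close>

definition outer :: "'k::field vec \<Rightarrow> 'k vec \<Rightarrow> 'k mat" where
  "outer v w = mat (dim_vec v) (dim_vec w) (\<lambda>(i, j). v $ i * w $ j)"

lemma outer_carrier: "v \<in> carrier_vec m \<Longrightarrow> w \<in> carrier_vec n \<Longrightarrow> outer v w \<in> carrier_mat m n"
  by (simp add: outer_def)

lemma outer_zero [simp]: "outer (0\<^sub>v m) w = 0\<^sub>m m (dim_vec w)" "outer w (0\<^sub>v m) = 0\<^sub>m (dim_vec w) m"
  by (auto simp: outer_def)

lemma transpose_outer: "transpose_mat (outer v w) = outer w v"
  by (auto simp: outer_def)

lemma mult_outer:
  assumes "A \<in> carrier_mat m n" "v \<in> carrier_vec n"
  shows "A * outer v w = outer (A *\<^sub>v v) w"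
  using assms
  by (auto simp: outer_def scalar_prod_def sum_distrib_right mult.assoc intro!: eq_matI sum.cong)

lemma outer_mult:
  assumes "A \<in> carrier_mat m n" "w \<in> carrier_vec m"
  shows "outer v w * A = outer v (transpose_mat A *\<^sub>v w)"
  using assms
  by (auto simp: outer_def scalar_prod_def sum_distrib_left ac_simps intro!: eq_matI sum.cong)

text \<open>For \<open>n\<close> at least 2 the diagonal entries make \<open>v $ 0\<close> and
  \<open>w $ 1\<close> nonzero, while their product is the vanishing entry (0, 1).\<close>

lemma outer_eq_smult_one:
  assumes "outer v w = c \<cdot>\<^sub>m 1\<^sub>m n" "c \<noteq> 0"
  shows "n \<le> 1"
proof (rule ccontr)
  assume "\<not> n \<le> 1"
  then have n: "0 < n" "1 < n" by auto
  have "dim_vec v = n" "dim_vec w = n"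
    using arg_cong[OF assms(1), of dim_row] arg_cong[OF assms(1), of dim_col]
    by (auto simp: outer_def)
  then have e: "v $ i * w $ j = (if i = j then c else 0)" if "i < n" "j < n" for i j
    using arg_cong[OF assms(1), of "\<lambda>A. A $$ (i, j)"] that by (auto simp: outer_def)
  show False using e[of 0 0] e[of 0 1] e[of 1 1] n assms(2) by auto
qed

lemma vec_nonzeroE:
  assumes "v \<in> carrier_vec n" "v \<noteq> 0\<^sub>v n"
  obtains i where "i < n" "v $ i \<noteq> 0"
  using assms by (metis carrier_vecD eq_vecI index_zero_vec(1,2))

lemma outer_nonzero:
  assumes "v \<in> carrier_vec m" "v \<noteq> 0\<^sub>v m" "w \<in> carrier_vec n" "w \<noteq> 0\<^sub>v n"
  shows "outer v w \<noteq> 0\<^sub>m m n"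
proof -
  obtain i where i: "i < m" "v $ i \<noteq> 0" using vec_nonzeroE assms by metis
  obtain j where j: "j < n" "w $ j \<noteq> 0" using vec_nonzeroE assms by metis
  have "outer v w $$ (i, j) \<noteq> 0" using i j assms by (simp add: outer_def)
  then show ?thesis using i j by auto
qed

lemma exists_mult_nonzero:
  fixes A :: "'k::field mat"
  assumes A: "A \<in> carrier_mat m n" and "\<phi> \<in> carrier_vec m" "transpose_mat A *\<^sub>v \<phi> \<noteq> 0\<^sub>v n"
  obtains w where "w \<in> carrier_vec n" "A *\<^sub>v w \<noteq> 0\<^sub>v m"
proof -
  have "transpose_mat A *\<^sub>v \<phi> \<in> carrier_vec n" using A by (intro carrier_vecI) auto
  then obtain j where j: "j < n" "(transpose_mat A *\<^sub>v \<phi>) $ j \<noteq> 0"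
    using vec_nonzeroE assms(3) by metis
  have "col A j \<bullet> \<phi> \<noteq> 0" using j A by simp
  then have "col A j \<noteq> 0\<^sub>v m" using assms(2) by auto
  moreover have "A *\<^sub>v unit_vec n j = col A j"
    using A j by (intro eq_vecI) (auto simp: scalar_prod_right_unit)
  ultimately show thesis using that[of "unit_vec n j"] by simp
qed

lemma zero_mult_vec [simp]:
  fixes v :: "'b::semiring_1 vec"
  shows "v \<in> carrier_vec n \<Longrightarrow> 0\<^sub>m m n *\<^sub>v v = 0\<^sub>v m"
  by (auto simp: scalar_prod_def)

text \<open>Injective transposes mean that \<open>A\<close> and \<open>B\<close> are onto, so
  \<open>m\<close> is at most \<open>n\<close> and at most \<open>l\<close>, and the block matrix
  [A | -B] has more columns than rows. Its columns are indexed by the disjoint sum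
  \<open><+>\<close>. Only the pair (v, w) is known to be nonzero; the common image may still
  vanish.\<close>

lemma exists_common_image:
  fixes A B :: "'k::field mat"
  assumes A: "A \<in> carrier_mat m n" and B: "B \<in> carrier_mat m l" and "m \<noteq> 0"
    and sA: "\<And>\<phi>. \<phi> \<in> carrier_vec m \<Longrightarrow> transpose_mat A *\<^sub>v \<phi> = 0\<^sub>v n \<Longrightarrow> \<phi> = 0\<^sub>v m"
    and sB: "\<And>\<phi>. \<phi> \<in> carrier_vec m \<Longrightarrow> transpose_mat B *\<^sub>v \<phi> = 0\<^sub>v l \<Longrightarrow> \<phi> = 0\<^sub>v m"
  obtains v w where "v \<in> carrier_vec n" "w \<in> carrier_vec l" "A *\<^sub>v v = B *\<^sub>v w"
    "v \<noteq> 0\<^sub>v n \<or> w \<noteq> 0\<^sub>v l"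
proof -
  have le: "m \<le> r" if C: "C \<in> carrier_mat m r"
    and inj: "\<And>\<phi>. \<phi> \<in> carrier_vec m \<Longrightarrow> transpose_mat C *\<^sub>v \<phi> = 0\<^sub>v r \<Longrightarrow> \<phi> = 0\<^sub>v m"
    for C :: "'k mat" and r
  proof (rule ccontr)
    assume "\<not> m \<le> r"
    then have "card {..<r} < card {..<m}" by simp
    then obtain c where c: "\<exists>k\<in>{..<m}. c k \<noteq> 0" "\<forall>j\<in>{..<r}. (\<Sum>k<m. c k * C $$ (k, j)) = 0"
      using exists_dependence[of "{..<r}" "{..<m}" "\<lambda>k j. C $$ (k, j)"] by auto
    have "transpose_mat C *\<^sub>v vec m c = 0\<^sub>v r"
      using c(2) C
      by (intro eq_vecI) (auto simp: scalar_prod_def atLeast0LessThan mult.commute intro!: sum.cong)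
    then have "vec m c = 0\<^sub>v m" by (intro inj) auto
    then have "\<forall>k<m. c k = 0" by (metis index_vec index_zero_vec(1))
    with c(1) show False by auto
  qed
  have "m \<le> n" "m \<le> l" using le[OF A sA] le[OF B sB] by auto
  then have "card {..<m} < card ({..<n} <+> {..<l})" using \<open>m \<noteq> 0\<close> by (simp add: card_Plus)
  then obtain c where c: "\<exists>k\<in>{..<n} <+> {..<l}. c k \<noteq> 0"
    "\<forall>i\<in>{..<m}. (\<Sum>k\<in>{..<n} <+> {..<l}. c k * case_sum (\<lambda>k. A $$ (i, k)) (\<lambda>k. - B $$ (i, k)) k) = 0"
    using exists_dependence[of "{..<m}" "{..<n} <+> {..<l}"
        "\<lambda>k i. case_sum (\<lambda>k. A $$ (i, k)) (\<lambda>k. - B $$ (i, k)) k"] by auto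
  define v where "v = vec n (\<lambda>k. c (Inl k))"
  define w where "w = vec l (\<lambda>k. c (Inr k))"
  have "A *\<^sub>v v = B *\<^sub>v w"
  proof (rule eq_vecI)
    fix i assume "i < dim_vec (B *\<^sub>v w)"
    then have i: "i < m" using B by simp
    have "(\<Sum>k<n. c (Inl k) * A $$ (i, k)) - (\<Sum>k<l. c (Inr k) * B $$ (i, k)) = 0"
      using c(2) i by (simp add: sum.Plus sum_negf)
    then show "(A *\<^sub>v v) $ i = (B *\<^sub>v w) $ i"
      using i A B by (simp add: v_def w_def scalar_prod_def atLeast0LessThan mult.commute)
  qed (use A B in auto)
  moreover have "v \<noteq> 0\<^sub>v n \<or> w \<noteq> 0\<^sub>v l"
  proof (rule ccontr)
    assume "\<not> ?thesis"
    then have "\<forall>k<n. c (Inl k) = 0" "\<forall>k<l. c (Inr k) = 0"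
      unfolding v_def w_def by (metis index_vec index_zero_vec(1))+
    with c(1) show False by auto
  qed
  ultimately show thesis using that[of v w] by (simp add: v_def w_def)
qed

text \<open>At an index of maximal \<open>rk\<close> in the support of an eigenvector, only the
  diagonal term of the eigenvalue equation survives. Hence every eigenvalue is a diagonal entry, and
  no permutation of the matrix is needed.\<close>

lemma spectral_radius_triangular_le:
  fixes A :: "complex mat"
  assumes A: "A \<in> carrier_mat n n" and "n > 0"
    and off: "\<And>i j. \<lbrakk>i < n; j < n; i \<noteq> j; A $$ (i, j) \<noteq> 0\<rbrakk> \<Longrightarrow> rk i < (rk j :: nat)"
    and diag: "\<And>i. i < n \<Longrightarrow> norm (A $$ (i, i)) \<le> b"
  shows "spectral_radius A \<le> b"
proof -
  obtain ev where "ev \<in> spectrum A" and r: "spectral_radius A = norm ev"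
    using spectral_radius_mem_max(1)[OF assms(1,2)] by auto
  then obtain v where v: "v \<in> carrier_vec n" "v \<noteq> 0\<^sub>v n" "A *\<^sub>v v = ev \<cdot>\<^sub>v v"
    using A by (auto simp: spectrum_def eigenvalue_def eigenvector_def)
  let ?S = "{i. i < n \<and> v $ i \<noteq> 0}"
  have "?S \<noteq> {}" using vec_nonzeroE[OF v(1,2)] by blast
  then have "Max (rk ` ?S) \<in> rk ` ?S" by (intro Max_in) auto
  then obtain i where "i \<in> ?S" "rk i = Max (rk ` ?S)" by auto
  then have i: "i \<in> ?S" "\<And>j. j \<in> ?S \<Longrightarrow> rk j \<le> rk i" by auto
  have "ev * v $ i = (A *\<^sub>v v) $ i" using v i by simp
  also have "\<dots> = (\<Sum>j<n. A $$ (i, j) * v $ j)"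
    using A v(1) i by (simp add: scalar_prod_def atLeast0LessThan)
  also have "\<dots> = (\<Sum>j\<in>{i}. A $$ (i, j) * v $ j)"
  proof (rule sum.mono_neutral_right)
    show "\<forall>j\<in>{..<n} - {i}. A $$ (i, j) * v $ j = 0"
    proof
      fix j assume "j \<in> {..<n} - {i}"
      then show "A $$ (i, j) * v $ j = 0" using off[of i j] i(1) i(2)[of j] by force
    qed
  qed (use i in auto)
  finally have "ev = A $$ (i, i)" using i by simp
  then show ?thesis using r diag i by simp
qed

section \<open>Representations with radical square zero\<close>

text \<open>All elements of the arrow type carry a matrix, those outside the quiver the zero matrix.
  Without an arrow set, duality is a mere exchange of \<open>s\<close> and \<open>t\<close>.\<close>

locale radsq_rep =
  fixes d :: "'v \<Rightarrow> nat" and M :: "'a \<Rightarrow> 'k::field mat" and s t :: "'a \<Rightarrow> 'v"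
  assumes carrier: "M a \<in> carrier_mat (d (t a)) (d (s a))"
    and comp: "t a = s b \<Longrightarrow> M b * M a = 0\<^sub>m (d (t b)) (d (s a))"
begin

lemma transpose_carrier: "transpose_mat (M a) \<in> carrier_mat (d (s a)) (d (t a))"
  using carrier by (rule transpose_carrier_mat[THEN iffD2])

definition socle_vec :: "'v \<Rightarrow> 'k vec \<Rightarrow> bool" where
  "socle_vec i w \<longleftrightarrow> w \<in> carrier_vec (d i) \<and> (\<forall>b. s b = i \<longrightarrow> M b *\<^sub>v w = 0\<^sub>v (d (t b)))"

text \<open>A linear form on the top at \<open>i\<close>: it vanishes on the image of every arrow
  ending there. Covectors are stored as column vectors, so transposing the arrows exchanges this
  notion with \<open>socle_vec\<close>.\<close>

definition top_covec :: "'v \<Rightarrow> 'k vec \<Rightarrow> bool" where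
  "top_covec i \<phi> \<longleftrightarrow> \<phi> \<in> carrier_vec (d i) \<and>
     (\<forall>a. t a = i \<longrightarrow> transpose_mat (M a) *\<^sub>v \<phi> = 0\<^sub>v (d (s a)))"

text \<open>The last clause is the intertwining condition for \<open>outer (w i) (\<phi> i)\<close>,
  rewritten by \<open>mult_outer\<close> and \<open>outer_mult\<close>; the middle one makes this
  endomorphism nonzero.\<close>

definition rank_one_endo :: "('v \<Rightarrow> 'k vec) \<Rightarrow> ('v \<Rightarrow> 'k vec) \<Rightarrow> bool" where
  "rank_one_endo w \<phi> \<longleftrightarrow> (\<forall>i. w i \<in> carrier_vec (d i) \<and> \<phi> i \<in> carrier_vec (d i)) \<and>
     (\<exists>i. w i \<noteq> 0\<^sub>v (d i) \<and> \<phi> i \<noteq> 0\<^sub>v (d i)) \<and>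
     (\<forall>a. outer (M a *\<^sub>v w (s a)) (\<phi> (s a)) = outer (w (t a)) (transpose_mat (M a) *\<^sub>v \<phi> (t a)))"

lemma dual: "radsq_rep d (\<lambda>a. transpose_mat (M a)) t s"
proof
  fix a b assume "s a = t b"
  then show "transpose_mat (M b) * transpose_mat (M a) = 0\<^sub>m (d (s b)) (d (t a))"
    using comp[of b a] transpose_mult[OF carrier[of a] carrier[of b, folded \<open>s a = t b\<close>]] by simp
qed (rule transpose_carrier)

lemma dual_rank_one_endo:
  "radsq_rep.rank_one_endo d (\<lambda>a. transpose_mat (M a)) t s \<phi> w \<longleftrightarrow> rank_one_endo w \<phi>"
proof -
  have "outer (transpose_mat (M a) *\<^sub>v \<phi> (t a)) (w (t a)) = outer (\<phi> (s a)) (M a *\<^sub>v w (s a)) \<longleftrightarrow>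
     outer (M a *\<^sub>v w (s a)) (\<phi> (s a)) = outer (w (t a)) (transpose_mat (M a) *\<^sub>v \<phi> (t a))" for a
    by (metis transpose_outer)
  then show ?thesis
    unfolding rank_one_endo_def radsq_rep.rank_one_endo_def[OF dual] by auto
qed

text \<open>This is the composite M -> top -> socle -> M at the vertex \<open>i\<close>; both sides
  of every intertwining condition vanish.\<close>

lemma rank_one_endo_top_soc:
  assumes "socle_vec i w" "w \<noteq> 0\<^sub>v (d i)" "top_covec i \<phi>" "\<phi> \<noteq> 0\<^sub>v (d i)"
  shows "\<exists>w \<phi>. rank_one_endo w \<phi>"
proof -
  define w' where "w' j = (if j = i then w else 0\<^sub>v (d j))" for j
  define \<phi>' where "\<phi>' j = (if j = i then \<phi> else 0\<^sub>v (d j))" for j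
  have c: "w' j \<in> carrier_vec (d j)" "\<phi>' j \<in> carrier_vec (d j)" for j
    using assms by (auto simp: w'_def \<phi>'_def socle_vec_def top_covec_def)
  have "M a *\<^sub>v w' (s a) = 0\<^sub>v (d (t a))" "transpose_mat (M a) *\<^sub>v \<phi>' (t a) = 0\<^sub>v (d (s a))" for a
    using assms carrier[of a] by (auto simp: w'_def \<phi>'_def socle_vec_def top_covec_def)
  then have "outer (M a *\<^sub>v w' (s a)) (\<phi>' (s a)) = outer (w' (t a)) (transpose_mat (M a) *\<^sub>v \<phi>' (t a))" for a
    using c[of "s a"] c[of "t a"] by auto
  then have "rank_one_endo w' \<phi>'"
    unfolding rank_one_endo_def using assms c by (auto simp: w'_def \<phi>'_def intro!: exI[of _ i])
  then show ?thesis by blast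
qed

text \<open>Without a form on the top, the incoming arrows jointly span the space at
  \<open>i\<close>, and an outgoing arrow kills their images. In matrices:
  \<open>M b * M a = 0\<close> makes each row of \<open>M b\<close> a top covector.\<close>

lemma outgoing_zero:
  assumes "\<And>\<phi>. top_covec i \<phi> \<Longrightarrow> \<phi> = 0\<^sub>v (d i)" "s b = i"
  shows "M b = 0\<^sub>m (d (t b)) (d (s b))"
proof -
  have "row (M b) r = 0\<^sub>v (d i)" if r: "r < d (t b)" for r
  proof (rule assms(1))
    have "transpose_mat (M a) *\<^sub>v row (M b) r = 0\<^sub>v (d (s a))" if "t a = i" for a
    proof (rule eq_vecI)
      fix j assume "j < dim_vec (0\<^sub>v (d (s a)) :: 'k vec)"
      then have j: "j < d (s a)" by simp
      have "(transpose_mat (M a) *\<^sub>v row (M b) r) $ j = col (M a) j \<bullet> row (M b) r"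
        using j carrier[of a] by simp
      also have "\<dots> = row (M b) r \<bullet> col (M a) j"
        by (rule comm_scalar_prod[of _ "d i"]) (use carrier[of a] carrier[of b] that assms(2) in \<open>auto intro!: carrier_vecI\<close>)
      also have "\<dots> = (M b * M a) $$ (r, j)"
        using j r carrier[of a] carrier[of b] by simp
      also have "\<dots> = 0" using comp[of a b] that assms(2) j r by simp
      finally show "(transpose_mat (M a) *\<^sub>v row (M b) r) $ j = 0\<^sub>v (d (s a)) $ j" using j by simp
    qed (use carrier[of a] in auto)
    then show "top_covec i (row (M b) r)"
      using carrier[of b] assms(2) by (auto simp: top_covec_def intro!: carrier_vecI)
  qed
  then have "M b $$ (r, j) = 0" if "r < d (t b)" "j < d (s b)" for r j
    using that carrier[of b] assms(2) by (metis carrier_matD index_row(1) index_zero_vec(1))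
  then show ?thesis using carrier[of b] by (intro eq_matI) auto
qed

lemma incoming_zero:
  assumes "\<And>w. socle_vec i w \<Longrightarrow> w = 0\<^sub>v (d i)" "t a = i"
  shows "M a = 0\<^sub>m (d (t a)) (d (s a))"
proof -
  interpret D: radsq_rep d "\<lambda>a. transpose_mat (M a)" t s by (rule dual)
  have "D.top_covec i w \<longleftrightarrow> socle_vec i w" for w
    by (simp add: D.top_covec_def socle_vec_def)
  then have "transpose_mat (M a) = 0\<^sub>m (d (s a)) (d (t a))"
    using D.outgoing_zero[of i a] assms by simp
  then show ?thesis by (metis transpose_transpose zero_transpose_mat)
qed

text \<open>Since \<phi> is not a form on the top although \<open>f\<close> does not detect it,
  \<open>e\<close> must end at \<open>c\<close> and pull \<phi> back to something nonzero. Pushing a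
  suitable \<open>w\<close> forward and \<phi> back along \<open>e\<close> gives the endomorphism.
  It is zero at \<open>q\<close>, which is compatible with \<open>f\<close>: either \<open>f\<close>
  kills \<phi>, or \<open>f\<close> starts at \<open>c\<close> and is zero by
  \<open>outgoing_zero\<close>.\<close>

lemma rank_one_endo_one_sided:
  assumes cosep: "\<And>\<phi>. top_covec c \<phi> \<Longrightarrow> \<phi> = 0\<^sub>v (d c)"
    and loops: "\<And>a. s a = t a \<Longrightarrow> M a = 0\<^sub>m (d (t a)) (d (s a))"
    and "p \<noteq> c" "q \<noteq> c" "p \<noteq> q" "e \<noteq> f"
    and e: "s e = p \<and> t e = c \<or> s e = c \<and> t e = p"
    and f: "s f = q \<and> t f = c \<or> s f = c \<and> t f = q"
    and rest: "\<And>a. a \<notin> {e, f} \<Longrightarrow> M a = 0\<^sub>m (d (t a)) (d (s a))"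
    and \<phi>: "\<phi> \<in> carrier_vec (d c)" "\<phi> \<noteq> 0\<^sub>v (d c)"
    and \<phi>f: "t f = c \<Longrightarrow> transpose_mat (M f) *\<^sub>v \<phi> = 0\<^sub>v (d (s f))"
  shows "\<exists>w \<phi>. rank_one_endo w \<phi>"
proof -
  have "transpose_mat (M e) *\<^sub>v \<phi> \<noteq> 0\<^sub>v (d (s e)) \<and> t e = c"
  proof (rule ccontr)
    assume H: "\<not> ?thesis"
    have "top_covec c \<phi>"
      unfolding top_covec_def
    proof (intro conjI allI impI)
      fix a assume "t a = c"
      then show "transpose_mat (M a) *\<^sub>v \<phi> = 0\<^sub>v (d (s a))"
        using H \<phi>f rest[of a] \<phi>(1) by (cases "a \<in> {e, f}") auto
    qed (rule \<phi>(1))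
    with cosep \<phi>(2) show False by blast
  qed
  then have te: "t e = c" "s e = p" and ne: "transpose_mat (M e) *\<^sub>v \<phi> \<noteq> 0\<^sub>v (d p)"
    using e \<open>p \<noteq> c\<close> by auto
  have Me: "M e \<in> carrier_mat (d c) (d p)" using carrier[of e] te by simp
  obtain w where w: "w \<in> carrier_vec (d p)" "M e *\<^sub>v w \<noteq> 0\<^sub>v (d c)"
    using exists_mult_nonzero[OF Me \<phi>(1) ne] .
  define w' where "w' i = (if i = p then w else if i = c then M e *\<^sub>v w else 0\<^sub>v (d i))" for i
  define \<phi>' where "\<phi>' i = (if i = p then transpose_mat (M e) *\<^sub>v \<phi> else if i = c then \<phi> else 0\<^sub>v (d i))" for i
  have c: "w' i \<in> carrier_vec (d i)" "\<phi>' i \<in> carrier_vec (d i)" for i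
    using w \<phi> Me by (auto simp: w'_def \<phi>'_def intro!: carrier_vecI)
  have "outer (M a *\<^sub>v w' (s a)) (\<phi>' (s a)) = outer (w' (t a)) (transpose_mat (M a) *\<^sub>v \<phi>' (t a))" for a
  proof -
    consider "a = e" | "a = f" "t f = c" "s f = q" | "M a = 0\<^sub>m (d (t a)) (d (s a))"
      using f rest[of a] outgoing_zero[OF cosep, of f] by blast
    then show ?thesis
    proof cases
      case 1
      then show ?thesis using te \<open>p \<noteq> c\<close> by (simp add: w'_def \<phi>'_def)
    next
      case 2
      then have "\<phi>' (s a) = 0\<^sub>v (d (s a))" "transpose_mat (M a) *\<^sub>v \<phi>' (t a) = 0\<^sub>v (d (s a))"
        using \<open>p \<noteq> c\<close> \<open>q \<noteq> c\<close> \<open>p \<noteq> q\<close> \<phi>f by (auto simp: \<phi>'_def)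
      then show ?thesis using c[of "t a"] carrier[of a] by simp
    next
      case 3
      then show ?thesis using c[of "s a"] c[of "t a"] by simp
    qed
  qed
  then have "rank_one_endo w' \<phi>'"
    unfolding rank_one_endo_def using c w \<phi> \<open>p \<noteq> c\<close>
    by (auto simp: w'_def \<phi>'_def intro!: exI[of _ c])
  then show ?thesis by blast
qed

lemma rank_one_endo_sink:
  assumes cosep: "\<And>\<phi>. top_covec c \<phi> \<Longrightarrow> \<phi> = 0\<^sub>v (d c)"
    and dc: "d c \<noteq> 0"
    and no: "\<And>i. (\<forall>w. socle_vec i w \<longrightarrow> w = 0\<^sub>v (d i)) \<or> (\<forall>\<phi>. top_covec i \<phi> \<longrightarrow> \<phi> = 0\<^sub>v (d i))"
    and "p \<noteq> c" "q \<noteq> c" "p \<noteq> q" "e \<noteq> f"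
    and e: "s e = p \<and> t e = c \<or> s e = c \<and> t e = p"
    and f: "s f = q \<and> t f = c \<or> s f = c \<and> t f = q"
    and loops: "\<And>a. s a = t a \<Longrightarrow> M a = 0\<^sub>m (d (t a)) (d (s a))"
    and rest: "\<And>a. a \<notin> {e, f} \<Longrightarrow> M a = 0\<^sub>m (d (t a)) (d (s a))"
  shows "\<exists>w \<phi>. rank_one_endo w \<phi>"
proof -
  let ?kills = "\<lambda>a \<phi>. t a = c \<longrightarrow> transpose_mat (M a) *\<^sub>v \<phi> = 0\<^sub>v (d (s a))"
  have u: "unit_vec (d c) 0 \<in> carrier_vec (d c)" "unit_vec (d c) 0 \<noteq> (0\<^sub>v (d c) :: 'k vec)"
    using dc by (auto simp: unit_vec_def zero_vec_def vec_eq_iff)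
  consider (f) \<phi> where "\<phi> \<in> carrier_vec (d c)" "\<phi> \<noteq> 0\<^sub>v (d c)" "?kills f \<phi>"
    | (e) \<phi> where "\<phi> \<in> carrier_vec (d c)" "\<phi> \<noteq> 0\<^sub>v (d c)" "?kills e \<phi>"
    | (none) "\<And>\<phi>. \<phi> \<in> carrier_vec (d c) \<Longrightarrow> ?kills f \<phi> \<Longrightarrow> \<phi> = 0\<^sub>v (d c)"
      "\<And>\<phi>. \<phi> \<in> carrier_vec (d c) \<Longrightarrow> ?kills e \<phi> \<Longrightarrow> \<phi> = 0\<^sub>v (d c)"
    by blast
  then show ?thesis
  proof cases
    case f
    then show ?thesis
      using rank_one_endo_one_sided[OF cosep loops assms(4-9) rest] by blast
  next
    case e
    then show ?thesis
      using rank_one_endo_one_sided[OF cosep loops assms(5,4) _ _ assms(9,8), of \<phi>] rest assms(6,7) by auto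
  next
    case none
    \<comment> \<open>An edge starting at \<open>c\<close> would satisfy \<open>?kills\<close>
      vacuously for the unit vector, so both edges end at \<open>c\<close>.\<close>
    have tf: "t f = c" "s f = q" and te: "t e = c" "s e = p"
      using none(1)[OF u(1)] none(2)[OF u(1)] u(2) e f by auto
    have Me: "M e \<in> carrier_mat (d c) (d p)" and Mf: "M f \<in> carrier_mat (d c) (d q)"
      using carrier[of e] carrier[of f] te tf by auto
    obtain v w where vw: "v \<in> carrier_vec (d p)" "w \<in> carrier_vec (d q)" "M e *\<^sub>v v = M f *\<^sub>v w"
      "v \<noteq> 0\<^sub>v (d p) \<or> w \<noteq> 0\<^sub>v (d q)"
    proof (rule exists_common_image[OF Me Mf dc])
      show "\<phi> = 0\<^sub>v (d c)" if "\<phi> \<in> carrier_vec (d c)" "transpose_mat (M e) *\<^sub>v \<phi> = 0\<^sub>v (d p)" for \<phi>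
        using none(2)[OF that(1)] that(2) te by simp
      show "\<phi> = 0\<^sub>v (d c)" if "\<phi> \<in> carrier_vec (d c)" "transpose_mat (M f) *\<^sub>v \<phi> = 0\<^sub>v (d q)" for \<phi>
        using none(1)[OF that(1)] that(2) tf by simp
    qed
    \<comment> \<open>Both edges are injective: a nonzero arrow leaving \<open>s a\<close> yields a
      form on the top there, so \<open>no\<close> excludes nonzero socle vectors. As
      \<open>a\<close> is the only nonzero arrow leaving \<open>s a\<close>, its kernel consists of
      socle vectors.\<close>
    have inj: "w = 0\<^sub>v (d (s a))" if a: "a \<in> {e, f}" "w \<in> carrier_vec (d (s a))" "M a *\<^sub>v w = 0\<^sub>v (d c)" for a w
    proof -
      have "M a \<noteq> 0\<^sub>m (d (t a)) (d (s a))" 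
      proof
        assume "M a = 0\<^sub>m (d (t a)) (d (s a))"
        then have "transpose_mat (M a) *\<^sub>v unit_vec (d c) 0 = 0\<^sub>v (d (s a))"
          using a(1) te tf by auto
        then show False using a(1) none(1)[OF u(1)] none(2)[OF u(1)] u(2) by auto
      qed
      then have "\<not> (\<forall>\<phi>. top_covec (s a) \<phi> \<longrightarrow> \<phi> = 0\<^sub>v (d (s a)))"
        using outgoing_zero[of "s a" a] by blast
      then have sep: "\<forall>w. socle_vec (s a) w \<longrightarrow> w = 0\<^sub>v (d (s a))" using no by blast
      have "M b *\<^sub>v w = 0\<^sub>v (d (t b))" if "s b = s a" for b
      proof (cases "b = a")
        case True
        then show ?thesis using a te tf by auto
      next
        case False
        then have "b \<notin> {e, f}" using a(1) that te tf \<open>p \<noteq> q\<close> by auto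
        then show ?thesis using rest[of b] a that by simp
      qed
      then show ?thesis using sep a by (auto simp: socle_vec_def)
    qed
    have wc: "M e *\<^sub>v v \<noteq> 0\<^sub>v (d c)" using inj[of e v] inj[of f w] vw te tf by auto
    \<comment> \<open>Any nonzero covector would do: it is pulled back along both edges, while the
      vectors at the leaves have the same image.\<close>
    define \<phi> where "\<phi> = (unit_vec (d c) 0 :: 'k vec)"
    have \<phi>: "\<phi> \<in> carrier_vec (d c)" "\<phi> \<noteq> 0\<^sub>v (d c)" using u by (auto simp: \<phi>_def)
    define w' where "w' i = (if i = p then v else if i = q then w else if i = c then M e *\<^sub>v v else 0\<^sub>v (d i))" for i
    define \<phi>' where "\<phi>' i = (if i = p then transpose_mat (M e) *\<^sub>v \<phi> else
       if i = q then transpose_mat (M f) *\<^sub>v \<phi> else if i = c then \<phi> else 0\<^sub>v (d i))" for i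
    have c: "w' i \<in> carrier_vec (d i)" "\<phi>' i \<in> carrier_vec (d i)" for i
      using vw \<phi> Me Mf by (auto simp: w'_def \<phi>'_def intro!: carrier_vecI)
    have "outer (M a *\<^sub>v w' (s a)) (\<phi>' (s a)) = outer (w' (t a)) (transpose_mat (M a) *\<^sub>v \<phi>' (t a))" for a
    proof (cases "a \<in> {e, f}")
      case True
      then show ?thesis
        using te tf vw \<open>p \<noteq> c\<close> \<open>q \<noteq> c\<close> \<open>p \<noteq> q\<close> by (auto simp: w'_def \<phi>'_def)
    next
      case False
      then show ?thesis using rest[of a] c[of "s a"] c[of "t a"] by simp
    qed
    then have "rank_one_endo w' \<phi>'"
      unfolding rank_one_endo_def using c wc \<phi> \<open>p \<noteq> c\<close> \<open>q \<noteq> c\<close>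
      by (auto simp: w'_def \<phi>'_def intro!: exI[of _ c])
    then show ?thesis by blast
  qed
qed

text \<open>If no endomorphism factors through a top and a socle vector at a single vertex, then every
  vertex is a source or a sink for the nonzero arrows; the case of a source follows
  from that of a sink by transposition.\<close>

theorem exists_rank_one_endo:
  assumes "p \<noteq> c" "q \<noteq> c" "p \<noteq> q" "e \<noteq> f"
    and e: "s e = p \<and> t e = c \<or> s e = c \<and> t e = p"
    and f: "s f = q \<and> t f = c \<or> s f = c \<and> t f = q"
    and star: "\<And>a. a \<notin> {e, f} \<Longrightarrow> s a \<noteq> t a \<Longrightarrow> M a = 0\<^sub>m (d (t a)) (d (s a))"
    and "d i \<noteq> 0"
  shows "\<exists>w \<phi>. rank_one_endo w \<phi>"
proof (rule ccontr)
  assume none: "\<not> ?thesis"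
  then have no: "(\<forall>w. socle_vec i w \<longrightarrow> w = 0\<^sub>v (d i)) \<or> (\<forall>\<phi>. top_covec i \<phi> \<longrightarrow> \<phi> = 0\<^sub>v (d i))" for i
    using rank_one_endo_top_soc by blast
  \<comment> \<open>A loop is both incoming and outgoing at its vertex, so either alternative in
    \<open>no\<close> kills it.\<close>
  have loops: "M a = 0\<^sub>m (d (t a)) (d (s a))" if "s a = t a" for a
    using no[of "s a"] outgoing_zero[of "s a" a] incoming_zero[of "s a" a] that by metis
  have rest: "M a = 0\<^sub>m (d (t a)) (d (s a))" if "a \<notin> {e, f}" for a
    using loops star that by blast
  interpret D: radsq_rep d "\<lambda>a. transpose_mat (M a)" t s by (rule dual)
  have D: "D.top_covec j w \<longleftrightarrow> socle_vec j w" "D.socle_vec j w \<longleftrightarrow> top_covec j w" for j w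
    by (auto simp: D.top_covec_def socle_vec_def D.socle_vec_def top_covec_def)
  show False
  proof (cases "d c = 0")
    case False
    show False
    proof (cases "\<forall>\<phi>. top_covec c \<phi> \<longrightarrow> \<phi> = 0\<^sub>v (d c)")
      case True
      then show False
        using rank_one_endo_sink[OF _ False no assms(1-4) e f loops rest] none by blast
    next
      case F: False
      then have sep: "\<And>w. D.top_covec c w \<Longrightarrow> w = 0\<^sub>v (d c)" using no[of c] D by blast
      have noD: "(\<forall>w. D.socle_vec j w \<longrightarrow> w = 0\<^sub>v (d j)) \<or> (\<forall>\<phi>. D.top_covec j \<phi> \<longrightarrow> \<phi> = 0\<^sub>v (d j))" for j
        using no[of j] D by blast
      have e': "t e = p \<and> s e = c \<or> t e = c \<and> s e = p"
        and f': "t f = q \<and> s f = c \<or> t f = c \<and> s f = q" using e f by auto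
      have "\<exists>w \<phi>. D.rank_one_endo w \<phi>"
        using D.rank_one_endo_sink[OF sep False noD assms(1-4) e' f'] loops rest by simp
      then show False using none dual_rank_one_endo by blast
    qed
  next
    case True
    \<comment> \<open>With a zero space at the centre all arrows vanish, so every vector lies in the
      socle and every covector is a form on the top, against \<open>no\<close>.\<close>
    have z: "M a = 0\<^sub>m (d (t a)) (d (s a))" for a
    proof (cases "a \<in> {e, f}")
      case True
      then show ?thesis using \<open>d c = 0\<close> e f carrier[of a] by (intro eq_matI) auto
    qed (rule rest)
    define u where "u = (unit_vec (d i) 0 :: 'k vec)"
    have u: "u \<in> carrier_vec (d i)" "u \<noteq> 0\<^sub>v (d i)"
      using \<open>d i \<noteq> 0\<close> by (auto simp: u_def unit_vec_def zero_vec_def vec_eq_iff)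
    have "transpose_mat (M a) = 0\<^sub>m (d (s a)) (d (t a))" for a using z[of a] by simp
    then have "socle_vec i u" "top_covec i u"
      using u(1) z by (auto simp: socle_vec_def top_covec_def)
    then show False using no[of i] u by blast
  qed
qed

end

section \<open>Bricks\<close>

lemma is_rep_radsq:
  assumes "is_rep V Ar s t X"
  shows "radsq_rep (fst X) (snd X) s t"
proof
  show c: "snd X a \<in> carrier_mat (fst X (t a)) (fst X (s a))" for a
    using assms by (cases "a \<in> Ar") (auto simp: is_rep_def)
  fix a b assume ab: "t a = s b"
  show "snd X b * snd X a = 0\<^sub>m (fst X (t b)) (fst X (s a))"
  proof (cases "a \<in> Ar \<and> b \<in> Ar")
    case True
    with ab assms show ?thesis by (simp add: is_rep_def)
  next
    case False
    then have "snd X a = 0\<^sub>m (fst X (t a)) (fst X (s a)) \<or> snd X b = 0\<^sub>m (fst X (t b)) (fst X (s b))"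
      using assms by (auto simp: is_rep_def)
    then show ?thesis
      using c[of a] c[of b] ab by auto
  qed
qed

lemma hom_indep_length_le:
  assumes "finite V" "is_rep V Ar s t X"
    and "set fs \<subseteq> hom_set Ar s t X Y" "indep_mod (fst Y) (fst X) {\<lambda>i. 0\<^sub>m (fst Y i) (fst X i)} fs"
  shows "length fs \<le> card (SIGMA i:V. {..<fst Y i} \<times> {..<fst X i})"
proof (rule indep_mod_length_le[OF _ _ _ assms(3,4)])
  fix f i r c
  assume "c < fst X i" "r < fst Y i" "(i, r, c) \<notin> (SIGMA i:V. {..<fst Y i} \<times> {..<fst X i})"
  then show "f i $$ (r, c) = 0" using assms(2) by (auto simp: is_rep_def)
qed (use \<open>finite V\<close> in auto)

lemma lincomb_single:
  "f x \<in> carrier_mat (R x) (C x) \<Longrightarrow> lincomb R C c [f] x = c 0 \<cdot>\<^sub>m f x"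
  by (auto simp: lincomb_def)

lemma lincomb_pair:
  "f x \<in> carrier_mat (R x) (C x) \<Longrightarrow> g x \<in> carrier_mat (R x) (C x) \<Longrightarrow>
    lincomb R C c [f, g] x = c 0 \<cdot>\<^sub>m f x + c 1 \<cdot>\<^sub>m g x"
  by (auto simp: lincomb_def)

lemma dim_hom_nonzero:
  assumes "finite V" "is_rep V Ar s t X"
    and f: "f \<in> hom_set Ar s t X Y" "f i \<noteq> 0\<^sub>m (fst Y i) (fst X i)"
  shows "dim_hom Ar s t X Y \<noteq> 0"
proof -
  let ?T = "{\<lambda>i. 0\<^sub>m (fst Y i) (fst X i)}"
  have c: "f j \<in> carrier_mat (fst Y j) (fst X j)" for j using f by (simp add: hom_set_def)
  obtain r k where rk: "r < fst Y i" "k < fst X i" "f i $$ (r, k) \<noteq> 0"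
    using f(2) c[of i] by (metis carrier_matD eq_matI index_zero_mat)
  have "c 0 = 0" if "lincomb (fst Y) (fst X) c [f] \<in> ?T" for c
  proof -
    have "c 0 \<cdot>\<^sub>m f i = 0\<^sub>m (fst Y i) (fst X i)"
      using that lincomb_single[of f i "fst Y" "fst X" c] c[of i] by simp
    then have "c 0 * f i $$ (r, k) = 0" using rk c[of i] by (metis carrier_matD index_smult_mat(1) index_zero_mat(1))
    then show ?thesis using rk by simp
  qed
  then have "indep_mod (fst Y) (fst X) ?T [f]" by (auto simp: indep_mod_def)
  then have "length [f] \<le> dim_hom Ar s t X Y"
    unfolding dim_hom_def using f(1) by (intro qdim_ge[OF hom_indep_length_le[OF assms(1,2)]]) auto
  then show ?thesis by simp
qed

lemma one_hom: "is_rep V Ar s t X \<Longrightarrow> (\<lambda>i. 1\<^sub>m (fst X i)) \<in> hom_set Ar s t X X"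
proof -
  assume "is_rep V Ar s t X"
  then interpret radsq_rep "fst X" "snd X" s t by (rule is_rep_radsq)
  show ?thesis
    by (simp add: hom_set_def left_mult_one_mat[OF carrier] right_mult_one_mat[OF carrier])
qed

lemma brick_nonzero:
  assumes "finite V" "is_brick V Ar s t X"
  obtains i where "fst X i \<noteq> 0"
proof (rule ccontr)
  assume "\<not> thesis"
  then have z: "fst X i = 0" for i using that by blast
  have X: "is_rep V Ar s t X" "dim_hom Ar s t X X = 1" using assms by (auto simp: is_brick_def)
  obtain fs where "set fs \<subseteq> hom_set Ar s t X X"
    "indep_mod (fst X) (fst X) {\<lambda>i. 0\<^sub>m (fst X i) (fst X i)} fs" "length fs = dim_hom Ar s t X X"
    unfolding dim_hom_def by (rule qdim_attained[OF hom_indep_length_le[OF assms(1) X(1)]])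
  then show False
    using hom_indep_length_le[OF assms(1) X(1), of fs X] X(2) by (simp add: z)
qed

text \<open>The identity and \<open>f\<close> are dependent in a space of dimension 1. The
  coefficient of \<open>f\<close> is nonzero because a brick has a nonzero vertex space, where the
  identity does not vanish.\<close>

lemma brick_endo_scalar:
  assumes "finite V" "is_brick V Ar s t X" "f \<in> hom_set Ar s t X X"
  obtains c where "\<And>i. f i = c \<cdot>\<^sub>m 1\<^sub>m (fst X i)"
proof -
  let ?T = "{\<lambda>i. 0\<^sub>m (fst X i) (fst X i)} :: (nat \<Rightarrow> 'b mat) set"
  let ?fs = "[\<lambda>i. 1\<^sub>m (fst X i), f]"
  have X: "is_rep V Ar s t X" "dim_hom Ar s t X X = 1" using assms by (auto simp: is_brick_def)
  have fc: "f i \<in> carrier_mat (fst X i) (fst X i)" for i using assms(3) by (simp add: hom_set_def)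
  have "set ?fs \<subseteq> hom_set Ar s t X X" using one_hom[OF X(1)] assms(3) by simp
  have "\<not> indep_mod (fst X) (fst X) ?T ?fs"
  proof
    assume "indep_mod (fst X) (fst X) ?T ?fs"
    then have "length ?fs \<le> dim_hom Ar s t X X"
      unfolding dim_hom_def using \<open>set ?fs \<subseteq> _\<close> by (intro qdim_ge[OF hom_indep_length_le[OF assms(1) X(1)]])
    with X(2) show False by simp
  qed
  then obtain c k where "lincomb (fst X) (fst X) c ?fs \<in> ?T" and k: "k < 2" "c k \<noteq> 0"
    by (auto simp: indep_mod_def numeral_2_eq_2)
  then have z: "c 0 \<cdot>\<^sub>m 1\<^sub>m (fst X i) + c 1 \<cdot>\<^sub>m f i = 0\<^sub>m (fst X i) (fst X i)" for i
    using lincomb_pair[of "\<lambda>i. 1\<^sub>m (fst X i)" i "fst X" "fst X" f c] fc by simp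
  have e: "c 0 * (if r = j then 1 else 0) + c 1 * f i $$ (r, j) = 0"
    if "r < fst X i" "j < fst X i" for i r j
    using arg_cong[OF z[of i], of "\<lambda>A. A $$ (r, j)"] that fc[of i] by (auto split: if_splits)
  obtain i where i: "fst X i \<noteq> 0" using brick_nonzero[OF assms(1,2)] .
  have "c 1 \<noteq> 0"
  proof
    assume "c 1 = 0"
    then have "c 0 = 0" using e[of 0 i 0] i by simp
    with k \<open>c 1 = 0\<close> show False by (auto simp: less_2_cases_iff)
  qed
  then have "f i = (- c 0 / c 1) \<cdot>\<^sub>m 1\<^sub>m (fst X i)" for i
    using e[of _ i] fc[of i]
    by (intro eq_matI) (auto simp: field_simps add_eq_0_iff split: if_splits)
  then show thesis using that by blast
qed

lemma (in radsq_rep) rank_one_endo_hom: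
  assumes "rank_one_endo w \<phi>"
  shows "(\<lambda>i. outer (w i) (\<phi> i)) \<in> {f. (\<forall>i. f i \<in> carrier_mat (d i) (d i)) \<and> (\<forall>a. f (t a) * M a = M a * f (s a))}"
  using assms carrier
  by (auto simp: rank_one_endo_def mult_outer[OF carrier] outer_mult[OF carrier] intro!: outer_carrier)

text \<open>The rank-one endomorphism is \<open>c\<close> times the identity with \<open>c\<close>
  nonzero, since it is nonzero at one vertex. Hence the identity has rank at most one at every
  vertex.\<close>

lemma brick_thin:
  assumes "finite V" "is_brick V Ar s t X"
    and "\<exists>w \<phi>. radsq_rep.rank_one_endo (fst X) (snd X) s t w \<phi>"
  shows "fst X i \<le> 1"
proof -
  interpret radsq_rep "fst X" "snd X" s t
    using assms(2) by (intro is_rep_radsq) (auto simp: is_brick_def)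
  obtain w \<phi> where r: "rank_one_endo w \<phi>" using assms(3) by blast
  then have "(\<lambda>i. outer (w i) (\<phi> i)) \<in> hom_set Ar s t X X"
    using rank_one_endo_hom[OF r] by (simp add: hom_set_def)
  then obtain c where c: "outer (w i) (\<phi> i) = c \<cdot>\<^sub>m 1\<^sub>m (fst X i)" for i
    using brick_endo_scalar[OF assms(1,2)] by metis
  obtain j where j: "outer (w j) (\<phi> j) \<noteq> 0\<^sub>m (fst X j) (fst X j)"
    using r outer_nonzero unfolding rank_one_endo_def by blast
  have "c \<noteq> 0"
  proof
    assume "c = 0"
    then have "outer (w j) (\<phi> j) = 0\<^sub>m (fst X j) (fst X j)" unfolding c by (intro eq_matI) auto
    with j show False by blast
  qed
  then show ?thesis using outer_eq_smult_one[OF c] by blast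
qed

section \<open>Thin representations\<close>

definition thin :: "('k::field, 'a) qrep \<Rightarrow> bool" where
  "thin X \<longleftrightarrow> (\<forall>i. fst X i \<le> 1)"

text \<open>The default 0 stands for a matrix with an empty side, so that products through a zero
  space come out right.\<close>

definition sc :: "('a \<Rightarrow> nat) \<Rightarrow> ('a \<Rightarrow> nat) \<Rightarrow> ('k::field, 'a) qrep \<Rightarrow> 'a \<Rightarrow> 'k" where
  "sc s t X a = (if fst X (s a) = 1 \<and> fst X (t a) = 1 then snd X a $$ (0, 0) else 0)"

lemma thin_cases: "thin X \<Longrightarrow> fst X i = 0 \<or> fst X i = 1"
  by (auto simp: thin_def le_Suc_eq)

lemma thin_mult_entry:
  assumes "A \<in> carrier_mat 1 k" "B \<in> carrier_mat k 1" "k = 0 \<or> k = 1"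
  shows "(A * B) $$ (0, 0) = (if k = 1 then A $$ (0, 0) * B $$ (0, 0) else 0)"
  using assms by (auto simp: scalar_prod_def)

lemma thin_sc_comp:
  assumes "is_rep V Ar s t X" "thin X" "t a = s b"
  shows "sc s t X b * sc s t X a = 0"
proof (cases "fst X (s a) = 1 \<and> fst X (t a) = 1 \<and> fst X (t b) = 1")
  case True
  interpret radsq_rep "fst X" "snd X" s t using assms(1) by (rule is_rep_radsq)
  have "snd X b $$ (0, 0) * snd X a $$ (0, 0) = (snd X b * snd X a) $$ (0, 0)"
    using thin_mult_entry[of "snd X b" 1 "snd X a"] carrier[of a] carrier[of b] True assms(3) by simp
  then show ?thesis using comp[OF assms(3)] True by (simp add: sc_def)
qed (auto simp: sc_def assms(3))

text \<open>The condition is demanded only where the matrix equation has an entry. Values of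
  \<gamma> off the common support are harmless, because there they are multiplied by an
  \<open>sc\<close> that is 0.\<close>

lemma thin_hom:
  assumes X: "is_rep V Ar s t X" "thin X" and Y: "is_rep V Ar s t Y" "thin Y"
    and \<gamma>: "\<And>a. \<lbrakk>a \<in> Ar; fst X (s a) = 1; fst Y (t a) = 1\<rbrakk> \<Longrightarrow>
      \<gamma> (t a) * sc s t X a = sc s t Y a * \<gamma> (s a)"
  shows "(\<lambda>i. mat (fst Y i) (fst X i) (\<lambda>_. \<gamma> i)) \<in> hom_set Ar s t X Y"
proof -
  interpret X: radsq_rep "fst X" "snd X" s t using X(1) by (rule is_rep_radsq)
  interpret Y: radsq_rep "fst Y" "snd Y" s t using Y(1) by (rule is_rep_radsq)
  let ?f = "\<lambda>i. mat (fst Y i) (fst X i) (\<lambda>_. \<gamma> i)"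
  have "?f (t a) * snd X a = snd Y a * ?f (s a)" if a: "a \<in> Ar" for a
  proof (rule eq_matI)
    fix r k assume "r < dim_row (snd Y a * ?f (s a))" "k < dim_col (snd Y a * ?f (s a))"
    then have "r < fst Y (t a)" "k < fst X (s a)" using Y.carrier[of a] by auto
    then have 1: "fst Y (t a) = 1" "fst X (s a) = 1" "r = 0" "k = 0"
      using thin_cases[OF X(2), of "s a"] thin_cases[OF Y(2), of "t a"] by auto
    have "(?f (t a) * snd X a) $$ (0, 0) = \<gamma> (t a) * sc s t X a"
      using thin_mult_entry[of "?f (t a)" "fst X (t a)" "snd X a"] X.carrier[of a] 1
        thin_cases[OF X(2), of "t a"] by (auto simp: sc_def)
    moreover have "(snd Y a * ?f (s a)) $$ (0, 0) = sc s t Y a * \<gamma> (s a)"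
      using thin_mult_entry[of "snd Y a" "fst Y (s a)" "?f (s a)"] Y.carrier[of a] 1
        thin_cases[OF Y(2), of "s a"] by (auto simp: sc_def)
    ultimately show "(?f (t a) * snd X a) $$ (r, k) = (snd Y a * ?f (s a)) $$ (r, k)"
      using \<gamma>[OF a] 1 by simp
  qed (use X.carrier[of a] Y.carrier[of a] in auto)
  then show ?thesis by (auto simp: hom_set_def)
qed

lemma thin_dim_hom_nonzero:
  assumes "finite V" and X: "is_rep V Ar s t X" "thin X" and Y: "is_rep V Ar s t Y" "thin Y"
    and \<gamma>: "\<And>a. \<lbrakk>a \<in> Ar; fst X (s a) = 1; fst Y (t a) = 1\<rbrakk> \<Longrightarrow>
      \<gamma> (t a) * sc s t X a = sc s t Y a * \<gamma> (s a)"
    and i: "fst X i = 1" "fst Y i = 1" "\<gamma> i \<noteq> 0"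
  shows "dim_hom Ar s t X Y \<noteq> 0"
proof (rule dim_hom_nonzero[OF assms(1) X(1)])
  show "(\<lambda>i. mat (fst Y i) (fst X i) (\<lambda>_. \<gamma> i)) \<in> hom_set Ar s t X Y"
    by (rule thin_hom[OF X Y]) (rule \<gamma>)
  have "mat (fst Y i) (fst X i) (\<lambda>_. \<gamma> i) $$ (0, 0) \<noteq> 0\<^sub>m (fst Y i) (fst X i) $$ (0, 0)" using i by simp
  then show "mat (fst Y i) (fst X i) (\<lambda>_. \<gamma> i) \<noteq> 0\<^sub>m (fst Y i) (fst X i)" by metis
qed

text \<open>Such a \<gamma> defines an endomorphism, which is a scalar. In other words, the nonzero
  arrows connect the support of a thin brick.\<close>

lemma thin_brick_connected:
  assumes "finite V" "is_brick V Ar s t X" "thin X"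
    and "\<And>a. \<lbrakk>a \<in> Ar; fst X (s a) = 1; fst X (t a) = 1\<rbrakk> \<Longrightarrow> \<gamma> (t a) * sc s t X a = sc s t X a * \<gamma> (s a)"
    and "fst X i = 1" "fst X j = 1"
  shows "\<gamma> i = \<gamma> j"
proof -
  have "is_rep V Ar s t X" using assms(2) by (simp add: is_brick_def)
  then have h: "(\<lambda>i. mat (fst X i) (fst X i) (\<lambda>_. \<gamma> i)) \<in> hom_set Ar s t X X"
    using assms(4) by (intro thin_hom) (auto simp: assms(3))
  obtain c where "mat (fst X i) (fst X i) (\<lambda>_. \<gamma> i) = c \<cdot>\<^sub>m 1\<^sub>m (fst X i)" for i
    by (rule brick_endo_scalar[OF assms(1,2) h]) blast
  from this[of i] this[of j] have "mat 1 1 (\<lambda>_. \<gamma> i) $$ (0, 0) = c" "mat 1 1 (\<lambda>_. \<gamma> j) $$ (0, 0) = c"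
    using assms(5,6) by auto
  then show ?thesis by simp
qed

section \<open>Extensions\<close>

lemma qdim_eq_0:
  assumes "S \<subseteq> T" and c: "\<And>f x. f \<in> S \<Longrightarrow> f x \<in> carrier_mat (R x) (C x)"
  shows "qdim R C S T = 0"
proof -
  have "length fs \<le> 0" if fs: "set fs \<subseteq> S" "indep_mod R C T fs" for fs
  proof (rule ccontr)
    assume "\<not> length fs \<le> 0"
    then have l: "0 < length fs" by simp
    then have f: "fs ! 0 \<in> S" using fs(1) nth_mem by blast
    have "lincomb R C (\<lambda>k. if k = 0 then 1 else 0) fs x = (fs ! 0) x" for x
      using c[OF f, of x] l
      by (intro eq_matI) (auto simp: lincomb_def if_distrib[of "\<lambda>z. z * _"] sum.delta cong: if_cong)
    then have "lincomb R C (\<lambda>k. if k = 0 then 1 else 0) fs = fs ! 0" by blast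
    then have "lincomb R C (\<lambda>k. if k = 0 then 1 else 0) fs \<in> T" using f assms(1) by auto
    from fs(2)[unfolded indep_mod_def, rule_format, OF this l] show False by simp
  qed
  then have "qdim R C S T \<le> 0" by (rule qdim_le)
  then show ?thesis by simp
qed

text \<open>In a product of two block matrices the diagonal blocks vanish because \<open>X\<close>
  and \<open>Y\<close> are representations; only the upper right block remains. Outside
  \<open>Ar\<close> that block is zero, so the quantifiers may range over all arrows.\<close>

lemma cocycle_comp_iff:
  assumes X: "is_rep V Ar s t X" and Y: "is_rep V Ar s t Y"
    and h: "\<And>a. h a \<in> carrier_mat (fst Y (t a)) (fst X (s a))"
      "\<And>a. a \<notin> Ar \<Longrightarrow> h a = 0\<^sub>m (fst Y (t a)) (fst X (s a))"
  shows "h \<in> ext_cocycles V Ar s t X Y \<longleftrightarrow>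
    (\<forall>a b. t a = s b \<longrightarrow> snd Y b * h a + h b * snd X a = 0\<^sub>m (fst Y (t b)) (fst X (s a)))"
    (is "_ \<longleftrightarrow> (\<forall>a b. _ \<longrightarrow> ?C a b = _)")
proof -
  interpret X: radsq_rep "fst X" "snd X" s t using X by (rule is_rep_radsq)
  interpret Y: radsq_rep "fst Y" "snd Y" s t using Y by (rule is_rep_radsq)
  let ?E = "ext_rep Ar s t X Y h"
  have prod: "snd ?E b * snd ?E a = four_block_mat (0\<^sub>m (fst Y (t b)) (fst Y (s a))) (?C a b)
      (0\<^sub>m (fst X (t b)) (fst Y (s a))) (0\<^sub>m (fst X (t b)) (fst X (s a)))"
    if "a \<in> Ar" "b \<in> Ar" "t a = s b" for a b
    using that X.carrier[of a] X.carrier[of b] Y.carrier[of a] Y.carrier[of b] h(1)[of a] h(1)[of b]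
      X.comp[of a b] Y.comp[of a b]
    by (simp add: ext_rep_def
        mult_four_block_mat[of _ "fst Y (t b)" "fst Y (s b)" _ "fst X (s b)" _ "fst X (t b)" _ _ "fst Y (s a)" _ "fst X (s a)"])
  have block: "four_block_mat (0\<^sub>m m n) B (0\<^sub>m k n) (0\<^sub>m k l) = 0\<^sub>m (m + k) (n + l) \<longleftrightarrow> B = 0\<^sub>m m l"
    if "B \<in> carrier_mat m l" for B :: "'b mat" and m n k l
  proof
    assume e: "four_block_mat (0\<^sub>m m n) B (0\<^sub>m k n) (0\<^sub>m k l) = 0\<^sub>m (m + k) (n + l)"
    show "B = 0\<^sub>m m l"
    proof (rule eq_matI)
      fix i j assume "i < dim_row (0\<^sub>m m l :: 'b mat)" "j < dim_col (0\<^sub>m m l :: 'b mat)"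
      then show "B $$ (i, j) = 0\<^sub>m m l $$ (i, j)"
        using arg_cong[OF e, of "\<lambda>A. A $$ (i, n + j)"] that by simp
    qed (use that in auto)
  qed (auto intro!: eq_matI)
  have C: "?C a b \<in> carrier_mat (fst Y (t b)) (fst X (s a))" if "t a = s b" for a b
    using that X.carrier[of a] Y.carrier[of b] h(1)[of a] h(1)[of b] by auto
  have off: "?C a b = 0\<^sub>m (fst Y (t b)) (fst X (s a))" if ab: "t a = s b" "a \<notin> Ar \<or> b \<notin> Ar" for a b
  proof -
    have z: "snd X a = 0\<^sub>m (fst X (t a)) (fst X (s a))" "snd Y a = 0\<^sub>m (fst Y (t a)) (fst Y (s a))" if "a \<notin> Ar" for a
      using X Y that by (auto simp: is_rep_def)
    from ab show ?thesis
      using h(2)[of a] h(2)[of b] z[of a] z[of b] X.carrier[of a] Y.carrier[of b] h(1)[of a] h(1)[of b] by auto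
  qed
  have "h \<in> ext_cocycles V Ar s t X Y \<longleftrightarrow> is_rep V Ar s t ?E"
    using h by (simp add: ext_cocycles_def)
  also have "\<dots> \<longleftrightarrow> (\<forall>a\<in>Ar. \<forall>b\<in>Ar. t a = s b \<longrightarrow>
      snd ?E b * snd ?E a = 0\<^sub>m (fst Y (t b) + fst X (t b)) (fst Y (s a) + fst X (s a)))"
    using X Y X.carrier Y.carrier h unfolding is_rep_def by (auto simp: ext_rep_def)
  also have "\<dots> \<longleftrightarrow> (\<forall>a\<in>Ar. \<forall>b\<in>Ar. t a = s b \<longrightarrow> ?C a b = 0\<^sub>m (fst Y (t b)) (fst X (s a)))"
    using prod block[OF C] by auto
  also have "\<dots> \<longleftrightarrow> (\<forall>a b. t a = s b \<longrightarrow> ?C a b = 0\<^sub>m (fst Y (t b)) (fst X (s a)))"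
    using off by blast
  finally show ?thesis .
qed

lemma zero_coboundary:
  assumes X: "is_rep V Ar s t X" and Y: "is_rep V Ar s t Y"
  shows "(\<lambda>a. 0\<^sub>m (fst Y (t a)) (fst X (s a))) \<in> ext_coboundaries Ar s t X Y"
proof -
  interpret X: radsq_rep "fst X" "snd X" s t using X by (rule is_rep_radsq)
  interpret Y: radsq_rep "fst Y" "snd Y" s t using Y by (rule is_rep_radsq)
  show ?thesis
    unfolding ext_coboundaries_def
    by (auto simp: left_mult_zero_mat[OF X.carrier] right_mult_zero_mat[OF Y.carrier]
        intro!: exI[of _ "\<lambda>i. 0\<^sub>m (fst Y i) (fst X i)"])
qed

text \<open>Between thin representations a cocycle amounts to a scalar \<eta> per arrow, and both
  the cocycle and the coboundary condition become scalar equations. It remains to solve for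
  \<gamma>, which \<open>split\<close> provides.\<close>

lemma thin_ext_eq_0:
  assumes X: "is_rep V Ar s t X" "thin X" and Y: "is_rep V Ar s t Y" "thin Y"
    and split: "\<And>\<eta>. \<lbrakk>\<And>a. fst X (s a) \<noteq> 1 \<or> fst Y (t a) \<noteq> 1 \<or> a \<notin> Ar \<Longrightarrow> \<eta> a = 0;
        \<And>a b. t a = s b \<Longrightarrow> sc s t Y b * \<eta> a + \<eta> b * sc s t X a = 0\<rbrakk>
      \<Longrightarrow> \<exists>\<gamma>. \<forall>a\<in>Ar. fst X (s a) = 1 \<longrightarrow> fst Y (t a) = 1 \<longrightarrow>
            \<eta> a = sc s t Y a * \<gamma> (s a) - \<gamma> (t a) * sc s t X a"
  shows "dim_ext1 V Ar s t X Y = 0"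
  unfolding dim_ext1_def
proof (rule qdim_eq_0)
  interpret X: radsq_rep "fst X" "snd X" s t using X(1) by (rule is_rep_radsq)
  interpret Y: radsq_rep "fst Y" "snd Y" s t using Y(1) by (rule is_rep_radsq)
  show "h a \<in> carrier_mat (fst Y (t a)) (fst X (s a))" if "h \<in> ext_cocycles V Ar s t X Y" for h a
    using that by (simp add: ext_cocycles_def)
  show "ext_cocycles V Ar s t X Y \<subseteq> ext_coboundaries Ar s t X Y"
  proof
    fix h assume h: "h \<in> ext_cocycles V Ar s t X Y"
    have hc: "h a \<in> carrier_mat (fst Y (t a)) (fst X (s a))" for a
      using h by (simp add: ext_cocycles_def)
    have h0: "h a = 0\<^sub>m (fst Y (t a)) (fst X (s a))" if "a \<notin> Ar" for a
      using h that by (simp add: ext_cocycles_def)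
    define \<eta> where "\<eta> a = (if fst X (s a) = 1 \<and> fst Y (t a) = 1 then h a $$ (0, 0) else 0)" for a
    have "sc s t Y b * \<eta> a + \<eta> b * sc s t X a = 0" if ab: "t a = s b" for a b
    proof (cases "fst X (s a) = 1 \<and> fst Y (t b) = 1")
      case True
      have "snd Y b * h a + h b * snd X a = 0\<^sub>m (fst Y (t b)) (fst X (s a))"
        using h cocycle_comp_iff[OF X(1) Y(1) hc h0] ab by blast
      then have "(snd Y b * h a + h b * snd X a) $$ (0, 0) = 0" using True by simp
      moreover have "(snd Y b * h a) $$ (0, 0) = sc s t Y b * \<eta> a"
        using thin_mult_entry[of "snd Y b" "fst Y (t a)" "h a"] Y.carrier[of b] hc[of a] True ab
          thin_cases[OF Y(2), of "t a"] by (auto simp: sc_def \<eta>_def)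
      moreover have "(h b * snd X a) $$ (0, 0) = \<eta> b * sc s t X a"
        using thin_mult_entry[of "h b" "fst X (t a)" "snd X a"] X.carrier[of a] hc[of b] True ab
          thin_cases[OF X(2), of "t a"] by (auto simp: sc_def \<eta>_def)
      ultimately show ?thesis using True hc[of b] X.carrier[of a] by simp
    qed (auto simp: sc_def \<eta>_def)
    moreover have "\<eta> a = 0" if "fst X (s a) \<noteq> 1 \<or> fst Y (t a) \<noteq> 1 \<or> a \<notin> Ar" for a
      using that h0[of a] by (auto simp: \<eta>_def)
    ultimately obtain \<gamma> where \<gamma>: "\<And>a. \<lbrakk>a \<in> Ar; fst X (s a) = 1; fst Y (t a) = 1\<rbrakk> \<Longrightarrow>
        \<eta> a = sc s t Y a * \<gamma> (s a) - \<gamma> (t a) * sc s t X a"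
      using split[of \<eta>] by blast
    define g where "g i = mat (fst Y i) (fst X i) (\<lambda>_. \<gamma> i)" for i
    have g: "g i \<in> carrier_mat (fst Y i) (fst X i)" for i by (simp add: g_def)
    have "h a = snd Y a * g (s a) - g (t a) * snd X a" if a: "a \<in> Ar" for a
    proof (rule eq_matI)
      fix r k assume "r < dim_row (snd Y a * g (s a) - g (t a) * snd X a)"
        "k < dim_col (snd Y a * g (s a) - g (t a) * snd X a)"
      then have "r < fst Y (t a)" "k < fst X (s a)" using X.carrier[of a] g[of "t a"] by auto
      then have 1: "fst Y (t a) = 1" "fst X (s a) = 1" "r = 0" "k = 0"
        using thin_cases[OF X(2), of "s a"] thin_cases[OF Y(2), of "t a"] by auto
      have "(snd Y a * g (s a)) $$ (0, 0) = sc s t Y a * \<gamma> (s a)"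
        using thin_mult_entry[of "snd Y a" "fst Y (s a)" "g (s a)"] Y.carrier[of a] g[of "s a"] 1
          thin_cases[OF Y(2), of "s a"] by (auto simp: sc_def g_def)
      moreover have "(g (t a) * snd X a) $$ (0, 0) = \<gamma> (t a) * sc s t X a"
        using thin_mult_entry[of "g (t a)" "fst X (t a)" "snd X a"] X.carrier[of a] g[of "t a"] 1
          thin_cases[OF X(2), of "t a"] by (auto simp: sc_def g_def)
      moreover have "h a $$ (0, 0) = sc s t Y a * \<gamma> (s a) - \<gamma> (t a) * sc s t X a"
        using \<gamma>[OF a] 1 by (simp add: \<eta>_def)
      ultimately show "h a $$ (r, k) = (snd Y a * g (s a) - g (t a) * snd X a) $$ (r, k)"
        using 1 X.carrier[of a] g[of "t a"] by simp
    qed (use hc[of a] X.carrier[of a] g[of "t a"] in auto)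
    then show "h \<in> ext_coboundaries Ar s t X Y"
      using g h0 by (auto simp: ext_coboundaries_def intro!: exI[of _ g])
  qed
qed

text \<open>A cocycle has an entry only at the loops at \<open>i\<close>, and exactly one
  there.\<close>

lemma one_point_ext_le:
  assumes X: "is_rep V Ar s t X" and d: "fst X = (\<lambda>j. if j = i then 1 else 0)"
    and "finite {a \<in> Ar. s a = i \<and> t a = i}"
  shows "dim_ext1 V Ar s t X X \<le> card {a \<in> Ar. s a = i \<and> t a = i}"
  unfolding dim_ext1_def
proof (rule qdim_le)
  let ?L = "{a \<in> Ar. s a = i \<and> t a = i}"
  let ?I = "(\<lambda>a. (a, 0::nat, 0::nat)) ` ?L"
  fix fs assume fs: "set fs \<subseteq> ext_cocycles V Ar s t X X"
    "indep_mod (\<lambda>a. fst X (t a)) (\<lambda>a. fst X (s a)) (ext_coboundaries Ar s t X X) fs"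
  have "length fs \<le> card ?I"
  proof (rule indep_mod_length_le[OF _ zero_coboundary[OF X X] _ fs])
    fix h a r k
    assume "h \<in> ext_cocycles V Ar s t X X" "r < fst X (t a)" "k < fst X (s a)" "(a, r, k) \<notin> ?I"
    then have "a \<notin> Ar" "r < fst X (t a)" "k < fst X (s a)" "h \<in> ext_cocycles V Ar s t X X"
      by (auto simp: d split: if_splits)
    then show "h a $$ (r, k) = 0" by (simp add: ext_cocycles_def)
  qed (use assms(3) in simp)
  also have "\<dots> \<le> card ?L" using assms(3) by (rule card_image_le)
  finally show "length fs \<le> card ?L" .
qed

section \<open>Simple modules and their self-extensions\<close>

definition simple_rep :: "('a \<Rightarrow> nat) \<Rightarrow> ('a \<Rightarrow> nat) \<Rightarrow> nat \<Rightarrow> ('k::field, 'a) qrep" where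
  "simple_rep s t i = (let d = (\<lambda>j. if j = i then 1 else 0) in (d, \<lambda>a. 0\<^sub>m (d (t a)) (d (s a))))"

lemma fst_simple_rep: "fst (simple_rep s t i) = (\<lambda>j. if j = i then 1 else 0)"
  and snd_simple_rep: "snd (simple_rep s t i) = (\<lambda>a. 0\<^sub>m (if t a = i then 1 else 0) (if s a = i then 1 else 0))"
  by (simp_all add: simple_rep_def Let_def)

lemma simple_rep_is_rep: "i \<in> V \<Longrightarrow> is_rep V Ar s t (simple_rep s t i)"
  unfolding is_rep_def snd_simple_rep by (auto simp: fst_simple_rep)

lemma simple_rep_brick:
  assumes "finite V" "i \<in> V"
  shows "is_brick V Ar s t (simple_rep s t i :: ('k::field, 'a) qrep)"
proof -
  let ?S = "simple_rep s t i :: ('k, 'a) qrep"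
  have r: "is_rep V Ar s t ?S" using assms(2) by (rule simple_rep_is_rep)
  have "(SIGMA j:V. {..<fst ?S j} \<times> {..<fst ?S j}) = {(i, 0, 0)}"
    using assms(2) by (auto simp: fst_simple_rep split: if_splits)
  then have "dim_hom Ar s t ?S ?S \<le> 1"
    unfolding dim_hom_def using hom_indep_length_le[OF assms(1) r, of _ ?S] by (intro qdim_le) auto
  moreover have "1\<^sub>m (fst ?S i) $$ (0, 0) \<noteq> (0\<^sub>m (fst ?S i) (fst ?S i) :: 'k mat) $$ (0, 0)"
    by (simp add: fst_simple_rep)
  then have "1\<^sub>m (fst ?S i) \<noteq> (0\<^sub>m (fst ?S i) (fst ?S i) :: 'k mat)" by metis
  then have "dim_hom Ar s t ?S ?S \<noteq> 0"
    using dim_hom_nonzero[OF assms(1) r one_hom[OF r]] by blast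
  ultimately show ?thesis using r by (simp add: is_brick_def)
qed

text \<open>All arrows act as zero, so every coboundary vanishes and the elementary family
  \<open>h l\<close> of each loop is a cocycle. The entry at the loop \<open>xs ! k\<close> isolates
  the coefficient \<open>c k\<close>.\<close>

lemma simple_rep_ext_ge:
  assumes "i \<in> V" and fin: "finite {a \<in> Ar. s a = i \<and> t a = i}"
  shows "card {a \<in> Ar. s a = i \<and> t a = i} \<le> dim_ext1 V Ar s t (simple_rep s t i :: ('k::field, 'a) qrep) (simple_rep s t i)"
proof -
  let ?L = "{a \<in> Ar. s a = i \<and> t a = i}"
  let ?S = "simple_rep s t i :: ('k, 'a) qrep"
  let ?T = "ext_coboundaries Ar s t ?S ?S"
  let ?R = "\<lambda>a. fst ?S (t a)" and ?C = "\<lambda>a. fst ?S (s a)"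
  have r: "is_rep V Ar s t ?S" using assms(1) by (rule simple_rep_is_rep)
  obtain xs where xs: "set xs = ?L" "distinct xs" using finite_distinct_list[OF fin] by blast
  define h where "h l a = mat (?R a) (?C a) (\<lambda>_. if a = l then 1 else 0 :: 'k)" for l a
  have "h l \<in> ext_cocycles V Ar s t ?S ?S" if "l \<in> ?L" for l
  proof (subst cocycle_comp_iff[OF r r])
    show "h l a = 0\<^sub>m (?R a) (?C a)" if "a \<notin> Ar" for a using that \<open>l \<in> ?L\<close> by (auto simp: h_def)
    show hc: "h l a \<in> carrier_mat (?R a) (?C a)" for a by (simp add: h_def)
    have z: "snd ?S a = 0\<^sub>m (?R a) (?C a)" for a by (simp add: snd_simple_rep fst_simple_rep)
    show "\<forall>a b. t a = s b \<longrightarrow> snd ?S b * h l a + h l b * snd ?S a = 0\<^sub>m (?R b) (?C a)"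
    proof (intro allI impI)
      fix a b assume "t a = s b"
      then show "snd ?S b * h l a + h l b * snd ?S a = 0\<^sub>m (?R b) (?C a)"
        using left_mult_zero_mat[OF hc[of a], of "?R b"] right_mult_zero_mat[OF hc[of b], of "?C a"]
        by (simp add: z)
    qed
  qed
  then have "set (map h xs) \<subseteq> ext_cocycles V Ar s t ?S ?S" using xs by auto
  moreover have "indep_mod ?R ?C ?T (map h xs)"
    unfolding indep_mod_def
  proof (intro allI impI)
    fix c k assume c: "lincomb ?R ?C c (map h xs) \<in> ?T" and k: "k < length (map h xs)"
    let ?a = "xs ! k"
    have a: "?a \<in> Ar" "s ?a = i" "t ?a = i" using k xs nth_mem[of k xs] by auto
    obtain g where g': "\<And>j. g j \<in> carrier_mat (fst ?S j) (fst ?S j)"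
      "\<And>a. lincomb ?R ?C c (map h xs) a =
        (if a \<in> Ar then snd ?S a * g (s a) - g (t a) * snd ?S a else 0\<^sub>m (?R a) (?C a))"
      using c unfolding ext_coboundaries_def by blast
    have g: "g i \<in> carrier_mat (fst ?S i) (fst ?S i)"
      "lincomb ?R ?C c (map h xs) ?a = snd ?S ?a * g i - g i * snd ?S ?a"
      using g'(1)[of i] g'(2)[of ?a] a by auto
    have "0 = lincomb ?R ?C c (map h xs) ?a $$ (0, 0)"
      unfolding g(2) using g(1) a by (simp add: snd_simple_rep fst_simple_rep)
    also have "\<dots> = (\<Sum>j<length xs. c j * (if j = k then 1 else 0))"
      using a k xs(2) by (auto simp: lincomb_def fst_simple_rep h_def nth_eq_iff_index_eq intro!: sum.cong)
    also have "\<dots> = (\<Sum>j<length xs. if j = k then c j else 0)" by (rule sum.cong) auto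
    also have "\<dots> = c k" using k by simp
    finally show "c k = 0" by simp
  qed
  \<comment> \<open>This upper bound only ensures that the \<open>Max\<close> in \<open>qdim\<close>
    ranges over a finite set.\<close>
  moreover have "length fs \<le> card ((\<lambda>a. (a, 0::nat, 0::nat)) ` ?L)"
    if "set fs \<subseteq> ext_cocycles V Ar s t ?S ?S" "indep_mod ?R ?C ?T fs" for fs
  proof (rule indep_mod_length_le[OF _ zero_coboundary[OF r r] _ that])
    fix h a r k
    assume "h \<in> ext_cocycles V Ar s t ?S ?S" "r < ?R a" "k < ?C a" "(a, r, k) \<notin> (\<lambda>a. (a, 0, 0)) ` ?L"
    then have "a \<notin> Ar" "r < ?R a" "k < ?C a" "h \<in> ext_cocycles V Ar s t ?S ?S"
      by (auto simp: fst_simple_rep split: if_splits)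
    then show "h a $$ (r, k) = 0" by (simp add: ext_cocycles_def)
  qed (use fin in simp)
  ultimately have "length (map h xs) \<le> dim_ext1 V Ar s t ?S ?S"
    unfolding dim_ext1_def by (intro qdim_ge)
  then show ?thesis using xs distinct_card[of xs] by simp
qed

section \<open>Type A with at most three vertices\<close>

locale typeA =
  fixes n :: nat and orient :: "nat \<Rightarrow> bool" and N :: "nat \<Rightarrow> nat"
  assumes n: "n \<in> {1, 2, 3}"
begin

abbreviation "V \<equiv> typeA_vertices n"
abbreviation "Ar \<equiv> typeA_arrows n N"
abbreviation "s \<equiv> typeA_src orient"
abbreviation "t \<equiv> typeA_tgt orient"
abbreviation "brick X \<equiv> is_brick V Ar s t X"
abbreviation "x X i \<equiv> sc s t X (Edge i)"
abbreviation "dhom X Y \<equiv> dim_hom Ar s t X Y"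
abbreviation "dext X Y \<equiv> dim_ext1 V Ar s t X Y"

lemma edge_ends [simp]:
  "s (Edge (Suc 0)) = (if orient (Suc 0) then Suc 0 else 2)" "t (Edge (Suc 0)) = (if orient (Suc 0) then 2 else Suc 0)"
  "s (Edge 2) = (if orient 2 then 2 else 3)" "t (Edge 2) = (if orient 2 then 3 else 2)"
  by auto

declare typeA_src.simps(1) [simp del] typeA_tgt.simps(1) [simp del]

lemma finite_V: "finite V"
  by (simp add: typeA_vertices_def)

lemma arrow_cases:
  assumes "a \<in> Ar"
  obtains "a = Edge 1" | "a = Edge 2" | i j where "a = Loop i j" "i \<in> {1, 2, 3}"
proof -
  from assms n have "a = Edge 1 \<or> a = Edge 2 \<or> (\<exists>i j. a = Loop i j \<and> i \<in> {1, 2, 3})"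
    unfolding typeA_arrows_def by auto
  then show thesis using that by blast
qed

lemma loops_at:
  assumes "i \<in> V"
  shows "{a \<in> Ar. s a = i \<and> t a = i} = Loop i ` {..<N i}"
proof -
  have "t (Edge j) \<noteq> s (Edge j)" for j
    by (simp add: typeA_src.simps typeA_tgt.simps)
  then show ?thesis using assms by (auto simp: typeA_arrows_def typeA_vertices_def)
qed

lemma brick_rep: "brick X \<Longrightarrow> is_rep V Ar s t X"
  by (simp add: is_brick_def)

lemma brick_is_thin:
  assumes "brick X"
  shows "thin X"
proof -
  interpret radsq_rep "fst X" "snd X" s t using brick_rep[OF assms] by (rule is_rep_radsq)
  obtain i where i: "fst X i \<noteq> 0" using brick_nonzero[OF finite_V assms] .
  have "snd X a = 0\<^sub>m (fst X (t a)) (fst X (s a))" if "a \<notin> {Edge 1, Edge 2}" "s a \<noteq> t a" for a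
  proof -
    have "a \<notin> Ar" using that by (auto elim: arrow_cases)
    then show ?thesis using brick_rep[OF assms] by (simp add: is_rep_def)
  qed
  \<comment> \<open>The star with centre 2 and leaves 1, 3 serves all three values of
    \<open>n\<close>: a missing vertex has dimension 0 and a missing edge the zero matrix.\<close>
  then have "\<exists>w \<phi>. rank_one_endo w \<phi>"
    using i by (intro exists_rank_one_endo[of 1 2 3 "Edge 1" "Edge 2"]) auto
  then show ?thesis using brick_thin[OF finite_V assms] by (simp add: thin_def)
qed

lemma brick_dim: "brick X \<Longrightarrow> fst X i = 0 \<or> fst X i = 1"
  using thin_cases[OF brick_is_thin] .

lemma brick_support: "brick X \<Longrightarrow> i \<notin> {1, 2, 3} \<Longrightarrow> fst X i = 0"
  using n brick_rep[of X] by (auto simp: is_rep_def typeA_vertices_def)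

lemma sc_loop: "brick X \<Longrightarrow> sc s t X (Loop i j) = 0"
  using thin_sc_comp[OF brick_rep brick_is_thin, of X "Loop i j" "Loop i j"] by simp

text \<open>Equally oriented edges form a path of length two through vertex 2, which acts as
  zero.\<close>

lemma x_comp: "brick X \<Longrightarrow> orient 1 = orient 2 \<Longrightarrow> x X 1 = 0 \<or> x X 2 = 0"
  using thin_sc_comp[OF brick_rep brick_is_thin, of X "Edge 1" "Edge 2"]
    thin_sc_comp[OF brick_rep brick_is_thin, of X "Edge 2" "Edge 1"]
  by (cases "orient 1") auto

lemma x_support: "x X 1 \<noteq> 0 \<Longrightarrow> fst X 1 = 1 \<and> fst X 2 = 1" "x X 2 \<noteq> 0 \<Longrightarrow> fst X 3 = 1 \<and> fst X 2 = 1"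
  by (auto simp: sc_def split: if_splits)

lemma brick_connected:
  fixes X :: "('k::field, qarrow) qrep" and \<gamma> :: "nat \<Rightarrow> 'k"
  assumes "brick X" "x X 1 \<noteq> 0 \<Longrightarrow> \<gamma> 1 = \<gamma> 2" "x X 2 \<noteq> 0 \<Longrightarrow> \<gamma> 2 = \<gamma> 3"
    "fst X i = 1" "fst X j = 1"
  shows "\<gamma> i = \<gamma> j"
proof -
  have e: "x X 1 = 0 \<or> \<gamma> 1 = \<gamma> 2" "x X 2 = 0 \<or> \<gamma> 2 = \<gamma> 3" using assms(2,3) by blast+
  show ?thesis
  proof (rule thin_brick_connected[OF finite_V assms(1) brick_is_thin[OF assms(1)] _ assms(4,5)])
    show "\<gamma> (t a) * sc s t X a = sc s t X a * \<gamma> (s a)" if "a \<in> Ar" for a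
      using that
    proof (cases rule: arrow_cases)
      case (3 i j)
      then show ?thesis using sc_loop[OF assms(1)] by simp
    qed (use e in auto)
  qed
qed

text \<open>If the edge acted as zero, the indicator function of the leaf would be an admissible
  \<gamma> that is not constant on the support.\<close>

lemma x_nonzero1: "brick X \<Longrightarrow> fst X 1 = 1 \<Longrightarrow> fst X 2 = 1 \<Longrightarrow> x X 1 \<noteq> 0"
  using brick_connected[of X "\<lambda>i. if i = 1 then 1 else 0" 1 2] by fastforce

lemma x_nonzero2: "brick X \<Longrightarrow> fst X 3 = 1 \<Longrightarrow> fst X 2 = 1 \<Longrightarrow> x X 2 \<noteq> 0"
  using brick_connected[of X "\<lambda>i. if i = 3 then 1 else 0" 3 2] by fastforce

lemma leaf_center:
  assumes "brick X" "fst X 1 = 1" "fst X 3 = 1"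
  shows "fst X 2 = 1"
proof (rule ccontr)
  assume "fst X 2 \<noteq> 1"
  then have "x X 1 = 0" "x X 2 = 0" using x_support[of X] by blast+
  then show False using brick_connected[of X "\<lambda>i. if i = 1 then 1 else 0" 1 3] assms by auto
qed

lemma brick_support_nonempty:
  assumes "brick X"
  shows "fst X 1 = 1 \<or> fst X 2 = 1 \<or> fst X 3 = 1"
  using brick_nonzero[OF finite_V assms] brick_support[OF assms] brick_dim[OF assms]
  by (metis insertE singletonD)

lemma hom_nonzero:
  assumes "brick X" "brick Y"
    and "\<And>e. \<lbrakk>e \<in> {Edge 1, Edge 2}; fst X (s e) = 1; fst Y (t e) = 1\<rbrakk>
      \<Longrightarrow> \<gamma> (t e) * sc s t X e = sc s t Y e * \<gamma> (s e)"
    and i: "fst X i = 1" "fst Y i = 1" "\<gamma> i \<noteq> 0"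
  shows "dhom X Y \<noteq> 0"
proof (rule thin_dim_hom_nonzero[where \<gamma> = \<gamma>, OF finite_V brick_rep[OF assms(1)] brick_is_thin[OF assms(1)]
    brick_rep[OF assms(2)] brick_is_thin[OF assms(2)] _ i])
  fix a assume a: "a \<in> Ar" "fst X (s a) = 1" "fst Y (t a) = 1"
  from a(1) show "\<gamma> (t a) * sc s t X a = sc s t Y a * \<gamma> (s a)"
  proof (cases rule: arrow_cases)
    case (3 i j)
    then show ?thesis using sc_loop[OF assms(1)] sc_loop[OF assms(2)] by simp
  qed (use assms(3) a(2,3) in blast)+
qed

lemma ext_eq_0:
  assumes "brick X" "brick Y"
    and "\<And>\<eta>. \<lbrakk>\<And>a. fst X (s a) \<noteq> 1 \<or> fst Y (t a) \<noteq> 1 \<Longrightarrow> \<eta> a = 0;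
        \<And>a b. t a = s b \<Longrightarrow> sc s t Y b * \<eta> a + \<eta> b * sc s t X a = 0\<rbrakk>
      \<Longrightarrow> (\<forall>i\<in>{1, 2, 3}. \<forall>j. \<eta> (Loop i j) = 0) \<and>
        (\<exists>\<gamma>. \<forall>a\<in>{Edge 1, Edge 2}. fst X (s a) = 1 \<longrightarrow> fst Y (t a) = 1 \<longrightarrow>
            \<eta> a = sc s t Y a * \<gamma> (s a) - \<gamma> (t a) * sc s t X a)"
  shows "dext X Y = 0"
proof (rule thin_ext_eq_0[OF brick_rep[OF assms(1)] brick_is_thin[OF assms(1)]
    brick_rep[OF assms(2)] brick_is_thin[OF assms(2)]])
  fix \<eta> :: "qarrow \<Rightarrow> 'a"
  assume 1: "\<And>a. fst X (s a) \<noteq> 1 \<or> fst Y (t a) \<noteq> 1 \<or> a \<notin> Ar \<Longrightarrow> \<eta> a = 0"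
    and 2: "\<And>a b. t a = s b \<Longrightarrow> sc s t Y b * \<eta> a + \<eta> b * sc s t X a = 0"
  from 1 have 3: "\<And>a. fst X (s a) \<noteq> 1 \<or> fst Y (t a) \<noteq> 1 \<Longrightarrow> \<eta> a = 0" by blast
  from assms(3)[of \<eta>, OF 3 2] obtain \<gamma> where l: "\<forall>i\<in>{1, 2, 3}. \<forall>j. \<eta> (Loop i j) = 0"
    and \<gamma>: "\<forall>a\<in>{Edge 1, Edge 2}. fst X (s a) = 1 \<longrightarrow> fst Y (t a) = 1 \<longrightarrow>
            \<eta> a = sc s t Y a * \<gamma> (s a) - \<gamma> (t a) * sc s t X a" by blast
  have "\<eta> a = sc s t Y a * \<gamma> (s a) - \<gamma> (t a) * sc s t X a"
    if a: "a \<in> Ar" "fst X (s a) = 1" "fst Y (t a) = 1" for a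
    using a(1)
  proof (cases rule: arrow_cases)
    case (3 i j)
    then have "\<eta> a = 0" using l by blast
    then show ?thesis using 3 sc_loop[OF assms(1)] sc_loop[OF assms(2)] by simp
  qed (use \<gamma> a(2,3) in blast)+
  then show "\<exists>\<gamma>. \<forall>a\<in>Ar. fst X (s a) = 1 \<longrightarrow> fst Y (t a) = 1 \<longrightarrow>
            \<eta> a = sc s t Y a * \<gamma> (s a) - \<gamma> (t a) * sc s t X a" by blast
qed

section \<open>Direction of the nonzero edges at the middle vertex 2, and extensions between bricks
  of equal direction\<close>

definition sink :: "('k::field, qarrow) qrep \<Rightarrow> bool" where
  "sink X \<longleftrightarrow> (orient 1 \<and> x X 1 \<noteq> 0) \<or> (\<not> orient 2 \<and> x X 2 \<noteq> 0)"

definition source :: "('k::field, qarrow) qrep \<Rightarrow> bool" where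
  "source X \<longleftrightarrow> (\<not> orient 1 \<and> x X 1 \<noteq> 0) \<or> (orient 2 \<and> x X 2 \<noteq> 0)"

lemma not_sink_source: "brick X \<Longrightarrow> sink X \<Longrightarrow> \<not> source X"
  using x_comp[of X] by (auto simp: sink_def source_def)

text \<open>Paths of length two kill \<eta> on the loops: at a leaf the loop is followed by a
  nonzero edge of \<open>Y\<close>, at vertex 2 it is preceded by a nonzero edge of
  \<open>X\<close>. On the edges \<eta> is a coboundary. The case \<open>X = Y\<close> shows that
  such bricks have no self-extensions.\<close>

lemma ext_sink_sink:
  fixes X Y :: "('k::field, qarrow) qrep"
  assumes X: "brick X" "sink X" and Y: "brick Y" "sink Y"
  shows "dext X Y = 0"
proof (rule ext_eq_0[OF X(1) Y(1)])
  fix \<eta> :: "qarrow \<Rightarrow> 'k"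
  assume 1: "\<And>a. fst X (s a) \<noteq> 1 \<or> fst Y (t a) \<noteq> 1 \<Longrightarrow> \<eta> a = 0"
    and 2: "\<And>a b. t a = s b \<Longrightarrow> sc s t Y b * \<eta> a + \<eta> b * sc s t X a = 0"
  have c: "fst X 2 = 1" "fst Y 2 = 1"
    using X Y x_support[of X] x_support[of Y] by (auto simp: sink_def)
  have nX: "\<not> source X" and nY: "\<not> source Y" using not_sink_source[OF X(1)] not_sink_source[OF Y(1)] X Y by auto
  \<comment> \<open>An edge between two vertices of the support acts nontrivially; if it left vertex
    2, the brick would be a source.\<close>
  have in1: "orient 1" if "fst X 1 = 1 \<or> fst Y 1 = 1"
    using that x_nonzero1[OF X(1)] x_nonzero1[OF Y(1)] c nX nY by (auto simp: source_def)
  have in2: "\<not> orient 2" if "fst X 3 = 1 \<or> fst Y 3 = 1"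
    using that x_nonzero2[OF X(1)] x_nonzero2[OF Y(1)] c nX nY by (auto simp: source_def)
  have "\<eta> (Loop 1 j) = 0" for j
  proof (cases "fst X 1 = 1 \<and> fst Y 1 = 1")
    case True
    then have "x Y 1 * \<eta> (Loop 1 j) = 0" 
      using 2[of "Loop 1 j" "Edge 1"] in1 sc_loop[OF X(1)] by simp
    then show ?thesis using x_nonzero1[OF Y(1)] True c by simp
  qed (use 1[of "Loop 1 j"] in auto)
  moreover have "\<eta> (Loop 3 j) = 0" for j
  proof (cases "fst X 3 = 1 \<and> fst Y 3 = 1")
    case True
    then have "x Y 2 * \<eta> (Loop 3 j) = 0" 
      using 2[of "Loop 3 j" "Edge 2"] in2 sc_loop[OF X(1)] by simp
    then show ?thesis using x_nonzero2[OF Y(1)] True c by simp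
  qed (use 1[of "Loop 3 j"] in auto)
  moreover have "\<eta> (Loop 2 j) = 0" for j
    using X(2) 2[of "Edge 1" "Loop 2 j"] 2[of "Edge 2" "Loop 2 j"] sc_loop[OF Y(1)]
    by (auto simp: sink_def)
  moreover have "\<exists>\<gamma>. \<forall>a\<in>{Edge 1, Edge 2}. fst X (s a) = 1 \<longrightarrow> fst Y (t a) = 1 \<longrightarrow>
            \<eta> a = sc s t Y a * \<gamma> (s a) - \<gamma> (t a) * sc s t X a"
  proof -
    \<comment> \<open>An edge whose leaf lies in \<open>Y\<close> can be solved for \<gamma> at that
      leaf, whatever \<gamma> is at 2. An edge whose leaf lies in \<open>X\<close> only prescribes
      \<gamma> at 2. As \<open>Y\<close> is a sink it contains a leaf, so at most one edge
      prescribes the value \<open>g\<close>.\<close>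
    define g where "g = (if fst X 1 = 1 \<and> fst Y 1 \<noteq> 1 then - \<eta> (Edge 1) / x X 1
      else if fst X 3 = 1 then - \<eta> (Edge 2) / x X 2 else 0)"
    define \<gamma> where "\<gamma> i = (if i = 2 then g
      else if i = 1 then (\<eta> (Edge 1) + g * x X 1) / x Y 1
      else (\<eta> (Edge 2) + g * x X 2) / x Y 2)" for i :: nat
    have "\<eta> (Edge 1) = x Y 1 * \<gamma> 1 - \<gamma> 2 * x X 1" if "fst X 1 = 1"
      using that x_nonzero1[OF X(1)] x_nonzero1[OF Y(1)] c x_support[of Y]
      by (cases "fst Y 1 = 1") (auto simp: \<gamma>_def g_def)
    moreover have "\<eta> (Edge 2) = x Y 2 * \<gamma> 3 - \<gamma> 2 * x X 2" if "fst X 3 = 1"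
    proof (cases "x Y 2 = 0")
      case True
      then have "fst Y 1 = 1" using Y(2) x_support[of Y] by (auto simp: sink_def)
      then show ?thesis
        using that True x_nonzero2[OF X(1)] c by (auto simp: \<gamma>_def g_def)
    qed (auto simp: \<gamma>_def)
    ultimately show ?thesis
    proof (intro exI[of _ \<gamma>] ballI impI)
      fix a assume e: "fst X 1 = 1 \<Longrightarrow> \<eta> (Edge 1) = x Y 1 * \<gamma> 1 - \<gamma> 2 * x X 1"
        "fst X 3 = 1 \<Longrightarrow> \<eta> (Edge 2) = x Y 2 * \<gamma> 3 - \<gamma> 2 * x X 2"
        and a: "a \<in> {Edge 1, Edge 2}" "fst X (s a) = 1" "fst Y (t a) = 1"
      from a consider "a = Edge 1" "orient 1" "fst X 1 = 1" | "a = Edge 2" "\<not> orient 2" "fst X 3 = 1"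
        using in1 in2 c by (auto split: if_splits)
      then show "\<eta> a = sc s t Y a * \<gamma> (s a) - \<gamma> (t a) * sc s t X a"
        by cases (use e in simp_all)
    qed
  qed
  ultimately show "(\<forall>i\<in>{1, 2, 3}. \<forall>j. \<eta> (Loop i j) = 0) \<and>
     (\<exists>\<gamma>. \<forall>a\<in>{Edge 1, Edge 2}. fst X (s a) = 1 \<longrightarrow> fst Y (t a) = 1 \<longrightarrow>
            \<eta> a = sc s t Y a * \<gamma> (s a) - \<gamma> (t a) * sc s t X a)" by blast
qed

text \<open>Mirror image of the sink case with the roles of \<open>X\<close> and \<open>Y\<close>
  exchanged: now the edges of \<open>X\<close> are solved at the leaves.\<close>

lemma ext_source_source:
  fixes X Y :: "('k::field, qarrow) qrep"
  assumes X: "brick X" "source X" and Y: "brick Y" "source Y"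
  shows "dext X Y = 0"
proof (rule ext_eq_0[OF X(1) Y(1)])
  fix \<eta> :: "qarrow \<Rightarrow> 'k"
  assume 1: "\<And>a. fst X (s a) \<noteq> 1 \<or> fst Y (t a) \<noteq> 1 \<Longrightarrow> \<eta> a = 0"
    and 2: "\<And>a b. t a = s b \<Longrightarrow> sc s t Y b * \<eta> a + \<eta> b * sc s t X a = 0"
  have c: "fst X 2 = 1" "fst Y 2 = 1"
    using X Y x_support[of X] x_support[of Y] by (auto simp: source_def)
  have nX: "\<not> sink X" and nY: "\<not> sink Y" using not_sink_source[OF X(1)] not_sink_source[OF Y(1)] X Y by auto
  have out1: "\<not> orient 1" if "fst X 1 = 1 \<or> fst Y 1 = 1"
    using that x_nonzero1[OF X(1)] x_nonzero1[OF Y(1)] c nX nY by (auto simp: sink_def)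
  have out2: "orient 2" if "fst X 3 = 1 \<or> fst Y 3 = 1"
    using that x_nonzero2[OF X(1)] x_nonzero2[OF Y(1)] c nX nY by (auto simp: sink_def)
  have "\<eta> (Loop 1 j) = 0" for j
  proof (cases "fst X 1 = 1 \<and> fst Y 1 = 1")
    case True
    then have "\<eta> (Loop 1 j) * x X 1 = 0" 
      using 2[of "Edge 1" "Loop 1 j"] out1 sc_loop[OF Y(1)] by simp
    then show ?thesis using x_nonzero1[OF X(1)] True c by simp
  qed (use 1[of "Loop 1 j"] in auto)
  moreover have "\<eta> (Loop 3 j) = 0" for j
  proof (cases "fst X 3 = 1 \<and> fst Y 3 = 1")
    case True
    then have "\<eta> (Loop 3 j) * x X 2 = 0" 
      using 2[of "Edge 2" "Loop 3 j"] out2 sc_loop[OF Y(1)] by simp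
    then show ?thesis using x_nonzero2[OF X(1)] True c by simp
  qed (use 1[of "Loop 3 j"] in auto)
  moreover have "\<eta> (Loop 2 j) = 0" for j
    using Y(2) 2[of "Loop 2 j" "Edge 1"] 2[of "Loop 2 j" "Edge 2"] sc_loop[OF X(1)]
    by (auto simp: source_def)
  moreover have "\<exists>\<gamma>. \<forall>a\<in>{Edge 1, Edge 2}. fst X (s a) = 1 \<longrightarrow> fst Y (t a) = 1 \<longrightarrow>
            \<eta> a = sc s t Y a * \<gamma> (s a) - \<gamma> (t a) * sc s t X a"
  proof -
    \<comment> \<open>The value at 2 is prescribed only by a leaf that lies in \<open>Y\<close> but
      not in \<open>X\<close>; there is at most one, since the source \<open>X\<close> contains a
      leaf.\<close>
    define g where "g = (if fst Y 1 = 1 \<and> fst X 1 \<noteq> 1 then \<eta> (Edge 1) / x Y 1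
      else if fst Y 3 = 1 then \<eta> (Edge 2) / x Y 2 else 0)"
    define \<gamma> where "\<gamma> i = (if i = 2 then g
      else if i = 1 then (x Y 1 * g - \<eta> (Edge 1)) / x X 1
      else (x Y 2 * g - \<eta> (Edge 2)) / x X 2)" for i :: nat
    have "\<eta> (Edge 1) = x Y 1 * \<gamma> 2 - \<gamma> 1 * x X 1" if "fst Y 1 = 1"
      using that x_nonzero1[OF X(1)] x_nonzero1[OF Y(1)] c x_support[of X]
      by (cases "fst X 1 = 1") (auto simp: \<gamma>_def g_def)
    moreover have "\<eta> (Edge 2) = x Y 2 * \<gamma> 2 - \<gamma> 3 * x X 2" if "fst Y 3 = 1"
    proof (cases "x X 2 = 0")
      case True
      then have "fst X 1 = 1" using X(2) x_support[of X] by (auto simp: source_def)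
      then show ?thesis
        using that True x_nonzero2[OF Y(1)] c by (auto simp: \<gamma>_def g_def)
    qed (auto simp: \<gamma>_def)
    ultimately show ?thesis
    proof (intro exI[of _ \<gamma>] ballI impI)
      fix a assume e: "fst Y 1 = 1 \<Longrightarrow> \<eta> (Edge 1) = x Y 1 * \<gamma> 2 - \<gamma> 1 * x X 1"
        "fst Y 3 = 1 \<Longrightarrow> \<eta> (Edge 2) = x Y 2 * \<gamma> 2 - \<gamma> 3 * x X 2"
        and a: "a \<in> {Edge 1, Edge 2}" "fst X (s a) = 1" "fst Y (t a) = 1"
      from a consider "a = Edge 1" "\<not> orient 1" "fst Y 1 = 1" | "a = Edge 2" "orient 2" "fst Y 3 = 1"
        using out1 out2 c by (auto split: if_splits)
      then show "\<eta> a = sc s t Y a * \<gamma> (s a) - \<gamma> (t a) * sc s t X a"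
        by cases (use e in simp_all)
    qed
  qed
  ultimately show "(\<forall>i\<in>{1, 2, 3}. \<forall>j. \<eta> (Loop i j) = 0) \<and>
     (\<exists>\<gamma>. \<forall>a\<in>{Edge 1, Edge 2}. fst X (s a) = 1 \<longrightarrow> fst Y (t a) = 1 \<longrightarrow>
            \<eta> a = sc s t Y a * \<gamma> (s a) - \<gamma> (t a) * sc s t X a)" by blast
qed

lemma ext_eq_0_disjoint:
  fixes X Y :: "('k::field, qarrow) qrep"
  assumes "brick X" "brick Y"
    and "\<And>i. i \<in> {1, 2, 3} \<Longrightarrow> fst X i = 1 \<Longrightarrow> fst Y i \<noteq> 1"
    and "\<And>e. e \<in> {Edge 1, Edge 2} \<Longrightarrow> fst X (s e) = 1 \<Longrightarrow> fst Y (t e) \<noteq> 1"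
  shows "dext X Y = 0"
proof (rule ext_eq_0[OF assms(1,2)])
  fix \<eta> :: "qarrow \<Rightarrow> 'k"
  assume "\<And>a. fst X (s a) \<noteq> 1 \<or> fst Y (t a) \<noteq> 1 \<Longrightarrow> \<eta> a = 0"
  then have "\<eta> (Loop i j) = 0" if "i \<in> {1, 2, 3}" for i j
    using assms(3)[OF that] by (metis typeA_src.simps(2) typeA_tgt.simps(2))
  then show "(\<forall>i\<in>{1, 2, 3}. \<forall>j. \<eta> (Loop i j) = 0) \<and>
     (\<exists>\<gamma>. \<forall>a\<in>{Edge 1, Edge 2}. fst X (s a) = 1 \<longrightarrow> fst Y (t a) = 1 \<longrightarrow>
            \<eta> a = sc s t Y a * \<gamma> (s a) - \<gamma> (t a) * sc s t X a)"
    using assms(4) by blast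
qed

text \<open>Extensions between distinct members of a brick set strictly increase this rank.\<close>

definition rank :: "('k::field, qarrow) qrep \<Rightarrow> nat" where
  "rank X = (if fst X 2 = 1 then 1
     else if fst X 1 = 1 \<and> orient 1 \<or> fst X 3 = 1 \<and> \<not> orient 2 then 0 else 2)"

text \<open>The map factors through the simple module at \<open>i\<close>: the two conditions put
  \<open>i\<close> into the socle of \<open>Y\<close> and into the top of \<open>X\<close>.\<close>

lemma hom_nonzero_at:
  assumes "brick X" "brick Y" "fst X i = 1" "fst Y i = 1"
    and "\<And>e. \<lbrakk>e \<in> {Edge 1, Edge 2}; s e = i; fst Y (t e) = 1\<rbrakk> \<Longrightarrow> sc s t Y e = 0"
    and "\<And>e. \<lbrakk>e \<in> {Edge 1, Edge 2}; t e = i; fst X (s e) = 1\<rbrakk> \<Longrightarrow> sc s t X e = 0"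
  shows "dhom X Y \<noteq> 0"
proof (rule hom_nonzero[of X Y "\<lambda>j. if j = i then 1 else 0" i])
  fix e assume "e \<in> {Edge 1, Edge 2}" "fst X (s e) = 1" "fst Y (t e) = 1"
  moreover from this have "s e \<noteq> t e" by (auto split: if_splits)
  ultimately show "(if t e = i then 1 else 0) * sc s t X e = sc s t Y e * (if s e = i then 1 else 0)"
    using assms(5,6)[of e] by auto
qed (use assms in auto)

text \<open>Otherwise vertex 2 lies in the top of \<open>X\<close> and in the socle of
  \<open>Y\<close>. Used in both directions, this forces orthogonal bricks through 2 to be both
  sinks or both sources.\<close>

lemma hom_center:
  assumes "brick X" "brick Y" "fst X 2 = 1" "fst Y 2 = 1" "dhom X Y = 0"
  shows "sink X \<or> source Y"
proof (rule ccontr)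
  assume "\<not> ?thesis"
  then have "dhom X Y \<noteq> 0"
    by (intro hom_nonzero_at[OF assms(1-4)]) (auto simp: sink_def source_def split: if_splits)
  then show False using assms(5) by simp
qed

text \<open>No nonzero edge of \<open>X\<close> ends at the leaf, so the leaf lies in the top of
  \<open>X\<close>; it lies in the socle of \<open>Y\<close> because \<open>Y\<close> misses the
  centre. In \<open>hom_leaf_in\<close> top and socle exchange roles.\<close>

lemma hom_leaf_out:
  assumes "brick X" "brick Y" "fst Y 2 = 0" "i \<in> {1, 3}" "fst X i = 1" "fst Y i = 1"
    and "i = 1 \<Longrightarrow> orient 1 \<or> fst X 2 = 0" "i = 3 \<Longrightarrow> \<not> orient 2 \<or> fst X 2 = 0"
  shows "dhom X Y \<noteq> 0"
  using assms
  by (intro hom_nonzero_at[OF assms(1,2,5,6)])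
     (auto simp: sc_def split: if_splits)

lemma hom_leaf_in:
  assumes "brick X" "brick Y" "fst X 2 = 0" "i \<in> {1, 3}" "fst X i = 1" "fst Y i = 1"
    and "i = 1 \<Longrightarrow> \<not> orient 1 \<or> fst Y 2 = 0" "i = 3 \<Longrightarrow> orient 2 \<or> fst Y 2 = 0"
  shows "dhom X Y \<noteq> 0"
  using assms
  by (intro hom_nonzero_at[OF assms(1,2,5,6)])
     (auto simp: sc_def split: if_splits)

text \<open>Arrows between different vertices lead from leaves of rank 0 to the centre, rank 1, and
  from there to leaves of rank 2. If the rank does not increase from \<open>X\<close> to
  \<open>Y\<close> and not both bricks contain the centre, no arrow leads from the support of
  \<open>X\<close> to that of \<open>Y\<close>, and orthogonality makes the supports disjoint.
  Bricks that share the centre have the same direction.\<close>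

lemma ext_orthogonal:
  fixes X Y :: "('k::field, qarrow) qrep"
  assumes X: "brick X" and Y: "brick Y" and h: "dhom X Y = 0" "dhom Y X = 0" and "rank Y \<le> rank X"
  shows "dext X Y = 0"
proof -
  note dims = brick_dim[OF X] brick_dim[OF Y]
  consider "fst X 2 = 1" "fst Y 2 = 1" | "fst X 2 = 1" "fst Y 2 = 0"
    | "fst X 2 = 0" "fst Y 2 = 1" | "fst X 2 = 0" "fst Y 2 = 0"
    using dims by metis
  then show ?thesis
  proof cases
    case 1
    then have "sink X \<and> sink Y \<or> source X \<and> source Y"
      using hom_center[OF X Y] hom_center[OF Y X] h not_sink_source[OF X] not_sink_source[OF Y] by blast
    then show ?thesis using ext_sink_sink[OF X _ Y] ext_source_source[OF X _ Y] by blast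
  next
    case 2
    \<comment> \<open>\<open>Y\<close> misses the centre and has rank at most 1, hence rank 0: its
      leaf points to the centre.\<close>
    then have "fst Y 1 = 1 \<and> orient 1 \<and> fst Y 3 = 0 \<or> fst Y 3 = 1 \<and> \<not> orient 2 \<and> fst Y 1 = 0"
      using assms(5) leaf_center[OF Y] dims(2)[of 1] dims(2)[of 3] by (auto simp: rank_def split: if_splits)
    then show ?thesis
      using 2 hom_leaf_out[OF X Y, of 1] hom_leaf_out[OF X Y, of 3] h dims(1)[of 1] dims(1)[of 3]
      by (intro ext_eq_0_disjoint[OF X Y]) (auto split: if_splits)
  next
    case 3
    \<comment> \<open>\<open>X\<close> misses the centre and has rank at least 1, hence rank 2: the
      edge points to its leaf.\<close>
    then have "fst X 1 = 1 \<and> \<not> orient 1 \<and> fst X 3 = 0 \<or> fst X 3 = 1 \<and> orient 2 \<and> fst X 1 = 0"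
      using assms(5) leaf_center[OF X] dims(1)[of 1] dims(1)[of 3] brick_support_nonempty[OF X]
      by (auto simp: rank_def split: if_splits)
    then show ?thesis
      using 3 hom_leaf_in[OF X Y, of 1] hom_leaf_in[OF X Y, of 3] h dims(2)[of 1] dims(2)[of 3]
      by (intro ext_eq_0_disjoint[OF X Y]) (auto split: if_splits)
  next
    case 4
    then show ?thesis
      using hom_leaf_in[OF X Y, of 1] hom_leaf_in[OF X Y, of 3] h
      by (intro ext_eq_0_disjoint[OF X Y]) (auto split: if_splits)
  qed
qed

text \<open>A brick with a nonzero edge is a sink or a source and has no self-extensions. Any other
  brick is concentrated at one vertex, where the loops bound the dimension.\<close>

lemma ext_self_le:
  assumes X: "brick X"
  shows "dext X X \<le> Max (N ` {1..n})"
proof -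
  have one: "dext X X \<le> Max (N ` {1..n})" if i: "i \<in> {1, 2, 3}" "fst X i = 1" "\<And>j. j \<in> {1, 2, 3} \<Longrightarrow> j \<noteq> i \<Longrightarrow> fst X j = 0" for i
  proof -
    have d: "fst X = (\<lambda>j. if j = i then 1 else 0)"
      using i brick_support[OF X] by (intro ext) auto
    have iV: "i \<in> V" using i(2) brick_rep[OF X] unfolding is_rep_def by (metis zero_neq_one)
    have "dext X X \<le> card (Loop i ` {..<N i})"
      using one_point_ext_le[OF brick_rep[OF X] d] loops_at[OF iV] by simp
    also have "\<dots> = N i" by (simp add: card_image inj_on_def)
    also have "\<dots> \<le> Max (N ` {1..n})" using iV by (intro Max_ge) (auto simp: typeA_vertices_def)
    finally show ?thesis .
  qed
  show ?thesis
  proof (cases "fst X 2 = 1")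
    case True
    show ?thesis
    proof (cases "sink X \<or> source X")
      case True
      then show ?thesis using ext_sink_sink[OF X _ X] ext_source_source[OF X _ X] by auto
    next
      case False
      then have "x X 1 = 0" "x X 2 = 0" by (auto simp: sink_def source_def)
      then have "fst X 1 = 0" "fst X 3 = 0"
        using x_nonzero1[OF X] x_nonzero2[OF X] True brick_dim[OF X] by blast+
      then show ?thesis using True by (intro one[of 2]) auto
    qed
  next
    case False
    then have "fst X 2 = 0" "fst X 1 = 1 \<and> fst X 3 = 0 \<or> fst X 1 = 0 \<and> fst X 3 = 1"
      using brick_dim[OF X] leaf_center[OF X] brick_support_nonempty[OF X] by metis+
    then show ?thesis using one[of 1] one[of 3] by auto
  qed
qed

theorem fpd_typeA: "fpd TYPE('k::field) V Ar s t = ereal (real (Max (N ` {1..n})))"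
proof (rule antisym)
  let ?m = "Max (N ` {1..n})"
  show "fpd TYPE('k) V Ar s t \<le> ereal (real ?m)"
    unfolding fpd_def
  proof (rule SUP_least)
    fix Xs :: "('k, qarrow) qrep list" assume "Xs \<in> {Xs. brick_set V Ar s t Xs}"
    then have Xs: "Xs \<noteq> []" "\<And>i. i < length Xs \<Longrightarrow> brick (Xs ! i)"
      "\<And>i j. i < length Xs \<Longrightarrow> j < length Xs \<Longrightarrow> i \<noteq> j \<Longrightarrow> dhom (Xs ! i) (Xs ! j) = 0"
      by (auto simp: brick_set_def)
    have "spectral_radius (adj_mat V Ar s t Xs) \<le> real ?m"
    proof (rule spectral_radius_triangular_le)
      show "adj_mat V Ar s t Xs \<in> carrier_mat (length Xs) (length Xs)" by (simp add: adj_mat_def)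
      show "rank (Xs ! i) < rank (Xs ! j)"
        if ij: "i < length Xs" "j < length Xs" "i \<noteq> j" "adj_mat V Ar s t Xs $$ (i, j) \<noteq> 0" for i j
      proof -
        have "dext (Xs ! i) (Xs ! j) \<noteq> 0" using ij by (simp add: adj_mat_def)
        then show ?thesis using ext_orthogonal[of "Xs ! i" "Xs ! j"] Xs ij by (metis not_le)
      qed
      show "norm (adj_mat V Ar s t Xs $$ (i, i)) \<le> real ?m" if "i < length Xs" for i
        using that ext_self_le[OF Xs(2)] by (simp add: adj_mat_def)
    qed (use Xs(1) in simp)
    then show "ereal (spectral_radius (adj_mat V Ar s t Xs)) \<le> ereal (real ?m)" by simp
  qed
  \<comment> \<open>For the lower bound, the simple module at a vertex with the most loops forms a
    brick set by itself, with a 1 x 1 adjacency matrix.\<close>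
  have "?m \<in> N ` {1..n}" using n by (intro Max_in) auto
  then obtain i where i: "i \<in> V" "N i = ?m" by (auto simp: typeA_vertices_def)
  let ?S = "simple_rep s t i :: ('k, qarrow) qrep"
  let ?A = "adj_mat V Ar s t [?S]"
  have b: "brick ?S" using simple_rep_brick[OF finite_V i(1)] .
  then have "brick_set V Ar s t [?S]" by (simp add: brick_set_def is_brick_def)
  then have le: "ereal (spectral_radius ?A) \<le> fpd TYPE('k) V Ar s t"
    unfolding fpd_def by (intro SUP_upper) simp
  have A: "?A \<in> carrier_mat 1 1" by (simp add: adj_mat_def)
  have "?A *\<^sub>v unit_vec 1 0 = of_nat (dext ?S ?S) \<cdot>\<^sub>v unit_vec 1 0"
    by (intro eq_vecI) (auto simp: adj_mat_def scalar_prod_def)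
  moreover have "unit_vec 1 0 \<noteq> (0\<^sub>v 1 :: complex vec)" by (simp add: vec_eq_iff)
  ultimately have "of_nat (dext ?S ?S) \<in> spectrum ?A"
    unfolding spectrum_def eigenvalue_def eigenvector_def mem_Collect_eq
    by (intro exI[of _ "unit_vec 1 0"]) (simp add: adj_mat_def)
  then have "norm (of_nat (dext ?S ?S) :: complex) \<le> spectral_radius ?A"
    by (intro spectral_radius_mem_max(2)[OF A] imageI) auto
  moreover have "?m \<le> dext ?S ?S"
  proof -
    have "card (Loop i ` {..<N i}) = ?m" using i by (simp add: card_image inj_on_def)
    then show ?thesis using simple_rep_ext_ge[of i V Ar s t, where 'k = 'k] loops_at[OF i(1)] i(1) by simp
  qed
  ultimately show "ereal (real ?m) \<le> fpd TYPE('k) V Ar s t"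
    using le by (intro order.trans[OF _ le]) simp
qed

end

theorem theorem6p1:
  fixes n :: nat and orient :: "nat \<Rightarrow> bool" and N :: "nat \<Rightarrow> nat"
  assumes "alg_closed TYPE('k::field)"
    and "n \<in> {1, 2, 3}"
  shows "fpd TYPE('k) (typeA_vertices n) (typeA_arrows n N) (typeA_src orient) (typeA_tgt orient)
           = ereal (real (Max (N ` {1..n})))"
proof -
  interpret typeA n orient N using assms(2) by unfold_locales
  show ?thesis by (rule fpd_typeA)
qed

end
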